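(* Let $n\ge3$, $p\in[0,1)$ and $t\in[0,1]$. For all convex bodies $K_0,K_1\subset\mathbb{R}^n$ containing the origin, it holds $$V_1\big((1-t)\cdot K_0+_pt\cdot K_1\big)^p\ \le\ (1-t)V_1(K_0)^p+tV_1(K_1)^p.$$ Moreover, equality holds if and only if either one of the two bodies $K_0$ and $K_1$ coincides with $\{0\}$, or they coincide up to a dilation.
   Context: A convex body in $\mathbb{R}^n$ is a (nonempty) compact convex subset of $\mathbb{R}^n$. The support function of a convex body $K$ is $h_K(x)=\sup\{(x,y):y\in K\}$, $x\in\mathbb{S}^{n-1}$, where $\mathbb{S}^{n-1}$ is the unit sphere and $(\cdot,\cdot)$ is the standard scalar product; $h_K\ge0$ if and only if $K$ contains the origin. For convex bodies $K_0,K_1$ containing the origin and $t\in[0,1]$, the $p$-combination is the Wulff shape $$(1-t)\cdot K_0+_pt\cdot K_1=\{x\in\mathbb{R}^n:(x,y)\le \big((1-t)h_{K_0}(y)^p+t\,h_{K_1}(y)^p\big)^{1/p}\ \ \forall y\in\mathbb{S}^{n-1}\}$$ for $p\in(0,1)$, and $$(1-t)\cdot K_0+_0t\cdot K_1=\{x\in\mathbb{R}^n:(x,y)\le h_{K_0}(y)^{1-t}h_{K_1}(y)^t\ \ \forall y\in\mathbb{S}^{n-1}\}$$ for $p=0$. $V_1$ denotes the first intrinsic volume, where the intrinsic volumes $V_0,\dots,V_n$ are defined through the Steiner formula $\mathcal{L}^n(K+\varepsilon B_n)=\sum_{k=0}^n\varepsilon^{n-k}\kappa_{n-k}V_k(K)$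 for $\varepsilon\ge0$; here $B_n$ is the closed unit ball, $\mathcal{L}^n$ is Lebesgue measure and $\kappa_j$ is the $j$-dimensional volume of the unit ball of $\mathbb{R}^j$.
   Formalization: For p=0, where the literal inequality is void, it is read as V_1(K) ≤ V_1(K_0)^{1-t} V_1(K_1)^t (with 0^0=1); "equality only if" is claimed only for 0<t<1, since for t=0 or t=1 equality always holds; the inequality and "if" are kept for all t in [0,1]. *)

theory Defs
  imports "HOL-Analysis.Analysis"
begin

definition convex_body :: "'a::euclidean_space set \<Rightarrow> bool" where
  "convex_body K \<longleftrightarrow> K \<noteq> {} \<and> compact K \<and> convex K"

definition support_fun :: "'a::euclidean_space set \<Rightarrow> 'a \<Rightarrow> real" where
  "support_fun K x = (SUP y\<in>K. x \<bullet> y)"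

text \<open>
  The real power \<open>a\<^sup>s\<close> of \<open>a \<ge> 0\<close> with exponent \<open>s \<ge> 0\<close>, with the convention that \<open>a\<^sup>0 = 1\<close> also
  for \<open>a = 0\<close>, whereas \<open>0 powr 0 = 0\<close>.
\<close>
definition nnpow :: "real \<Rightarrow> real \<Rightarrow> real" where
  "nnpow a s = (if s = 0 then 1 else a powr s)"

text \<open>The weighted \<open>p\<close>-mean of two nonnegative numbers; for \<open>p = 0\<close> the geometric mean.\<close>
definition p_mean :: "real \<Rightarrow> real \<Rightarrow> real \<Rightarrow> real \<Rightarrow> real" where
  "p_mean p t a b =
     (if p = 0 then nnpow a (1 - t) * nnpow b t
      else ((1 - t) * a powr p + t * b powr p) powr (1 / p))"

text \<open>The Wulff shape \<open>(1 - t) \<cdot> K\<^sub>0 +\<^sub>p t \<cdot> K\<^sub>1\<close>.\<close>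
definition p_combination ::
    "real \<Rightarrow> real \<Rightarrow> 'a::euclidean_space set \<Rightarrow> 'a set \<Rightarrow> 'a set" where
  "p_combination p t K0 K1 =
     {x. \<forall>y\<in>sphere 0 1. x \<bullet> y \<le> p_mean p t (support_fun K0 y) (support_fun K1 y)}"

text \<open>
  The intrinsic volumes are the coefficients in the Steiner formula; \<open>unit_ball_vol\<close> is the
  library's \<open>\<kappa>\<close>, with \<open>\<kappa>\<^sub>0 = 1\<close>. The values for \<open>k\<close> above the dimension, which the formula leaves
  undetermined, are set to \<open>0\<close> so that the sequence of coefficients is unique.
\<close>
definition intrinsic_volume :: "nat \<Rightarrow> 'a::euclidean_space set \<Rightarrow> real" where
  "intrinsic_volume k K =
     (THE V :: nat \<Rightarrow> real.
        (\<forall>j > DIM('a). V j = 0) \<and>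
        (\<forall>\<epsilon>\<ge>0. measure lebesgue {x + \<epsilon> *\<^sub>R u | x u. x \<in> K \<and> u \<in> cball 0 1} =
           (\<Sum>j\<le>DIM('a). \<epsilon> ^ (DIM('a) - j) * unit_ball_vol (real (DIM('a) - j)) * V j))) k"

end

(*
  V_1 is Minkowski additive, homogeneous and strictly monotone on convex bodies containing the
  origin. The p-mean of two nonnegative numbers (p < 1) is concave, hence lies below its tangent
  alpha a + beta b at (V_1(K_0), V_1(K_1)), with equality only on the ray through that point. So the
  p-combination is contained in alpha K_0 + beta K_1, whose V_1 is the p-mean of V_1(K_0) and
  V_1(K_1); equality forces the two bodies to coincide and h_{K_0}, h_{K_1} to be proportional.

  For the Steiner formula: vol(K + t[0,v]) is affine in t, so vol(K + e Z) is a polynomial in e for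
  every zonotope Z, of degree at most n by its growth; the ball is a limit of zonotopes. Comparing
  B + d K with the star body of radial function 1 + d h_K, as d tends to 0, identifies V_1 with a
  multiple of the mean of h_K.
*)

theory Submission
  imports Defs "HOL-Library.Set_Algebras" "HOL-Computational_Algebra.Polynomial"
begin

section \<open>Support functions\<close>

text \<open>The tangent has no constant term because the p-mean is homogeneous of degree 1; this is
  what makes its values the support function of a Minkowski combination. The support function of a
  Wulff shape is only known to lie below the p-mean, so the Wulff shape is never computed in
  general: it is compared with the combination by inclusion. Most of the work concerns V_1. It is a
  definite description over the Steiner formula, so nothing can be said about it before the volume
  of K + e B is known to be a polynomial of degree at most n. Zonotopes approaching the ball may
  have ever more segments, and only a degree bound uniform in their number makes the limit a
  polynomial again. Averages over directions are written as integrals over the solid ball, with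
  \<open>sgn x\<close> as the direction. The constant n / kappa_(n-1) in front of the average of h_K
  combines the n from differentiating r^n with the kappa_(n-1) of the Steiner formula.\<close>

lemma convex_body_plus:
  assumes "convex_body K" "convex_body L"
  shows "convex_body (K + L)"
proof -
  have "compact ((\<lambda>z. fst z + snd z) ` (K \<times> L))"
    using assms by (intro compact_continuous_image compact_Times continuous_intros)
      (auto simp: convex_body_def)
  moreover have "(\<lambda>z. fst z + snd z) ` (K \<times> L) = K + L"
    by (force simp: set_plus_def image_iff)
  ultimately show ?thesis
    using assms convex_set_plus[of K L] by (auto simp: convex_body_def set_plus_def)
qed

lemma convex_body_scaleR:
  assumes "convex_body K"
  shows "convex_body ((*\<^sub>R) c ` K)"
  using assms by (auto simp: convex_body_def compact_scaling convex_scaling)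

lemma convex_body_translation:
  assumes "convex_body K"
  shows "convex_body ((+) a ` K)"
  using assms by (auto simp: convex_body_def compact_translation)

lemma convex_body_cball [simp]: "0 \<le> r \<Longrightarrow> convex_body (cball a r)"
  by (auto simp: convex_body_def)

lemma convex_body_closed_segment [simp]: "convex_body (closed_segment a b)"
  by (auto simp: convex_body_def)

lemma zero_in_plus: "0 \<in> K \<Longrightarrow> 0 \<in> L \<Longrightarrow> 0 \<in> K + L" for K L :: "'a::monoid_add set"
  by (auto simp: set_plus_def intro!: bexI[of _ 0])

lemma bdd_above_inner_image:
  assumes "compact K"
  shows "bdd_above ((\<lambda>y. x \<bullet> y) ` K)"
  by (intro bounded_imp_bdd_above compact_imp_bounded compact_continuous_image continuous_intros assms)

lemma inner_le_support_fun:
  assumes "convex_body K" "y \<in> K"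
  shows "x \<bullet> y \<le> support_fun K x"
  unfolding support_fun_def using assms
  by (auto simp: convex_body_def intro!: cSUP_upper bdd_above_inner_image)

lemma support_fun_attained:
  assumes "convex_body K"
  obtains y where "y \<in> K" "support_fun K x = x \<bullet> y"
proof -
  have "\<exists>y\<in>K. \<forall>z\<in>K. x \<bullet> z \<le> x \<bullet> y"
    using assms by (intro continuous_attains_sup continuous_intros) (auto simp: convex_body_def)
  then obtain y where y: "y \<in> K" "\<And>z. z \<in> K \<Longrightarrow> x \<bullet> z \<le> x \<bullet> y"
    by auto
  then have "support_fun K x \<le> x \<bullet> y"
    unfolding support_fun_def by (intro cSUP_least) auto
  with inner_le_support_fun[OF assms y(1), of x] y(1) that show ?thesis
    by fastforce
qed

lemma support_fun_le:
  assumes "convex_body K" "\<And>y. y \<in> K \<Longrightarrow> x \<bullet> y \<le> b"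
  shows "support_fun K x \<le> b"
  by (metis assms support_fun_attained)

lemma support_fun_nonneg:
  assumes "convex_body K" "0 \<in> K"
  shows "0 \<le> support_fun K x"
  using inner_le_support_fun[OF assms, of x] by simp

lemma support_fun_mono:
  assumes "convex_body K" "convex_body L" "K \<subseteq> L"
  shows "support_fun K x \<le> support_fun L x"
  using assms by (intro support_fun_le) (auto intro: inner_le_support_fun)

lemma support_fun_plus:
  assumes "convex_body K" "convex_body L"
  shows "support_fun (K + L) x = support_fun K x + support_fun L x"
proof (rule antisym)
  show "support_fun (K + L) x \<le> support_fun K x + support_fun L x"
    using assms
    by (intro support_fun_le convex_body_plus)
      (auto simp: set_plus_def inner_add_right intro!: add_mono inner_le_support_fun)
  obtain y z where "y \<in> K" "support_fun K x = x \<bullet> y" "z \<in> L" "support_fun L x = x \<bullet> z"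
    using assms by (metis support_fun_attained)
  then show "support_fun K x + support_fun L x \<le> support_fun (K + L) x"
    using inner_le_support_fun[OF convex_body_plus[OF assms], of "y + z" x]
    by (auto simp: set_plus_def inner_add_right)
qed

lemma support_fun_scaleR_set:
  assumes "convex_body K" "0 \<le> c"
  shows "support_fun ((*\<^sub>R) c ` K) x = c * support_fun K x"
proof (rule antisym)
  show "support_fun ((*\<^sub>R) c ` K) x \<le> c * support_fun K x"
    using assms by (intro support_fun_le convex_body_scaleR)
      (auto intro!: mult_left_mono inner_le_support_fun)
  obtain y where "y \<in> K" "support_fun K x = x \<bullet> y"
    using assms by (metis support_fun_attained)
  then show "c * support_fun K x \<le> support_fun ((*\<^sub>R) c ` K) x"
    using inner_le_support_fun[OF convex_body_scaleR[OF assms(1)], of "c *\<^sub>R y" c x] by auto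
qed

lemma support_fun_scaleR:
  assumes "convex_body K" "0 \<le> c"
  shows "support_fun K (c *\<^sub>R x) = c * support_fun K x"
proof -
  have "support_fun K (c *\<^sub>R x) = support_fun ((*\<^sub>R) c ` K) x"
    by (simp add: support_fun_def image_image)
  then show ?thesis
    by (simp add: support_fun_scaleR_set assms)
qed

lemma support_fun_zero [simp]: "convex_body K \<Longrightarrow> support_fun K 0 = 0"
  using support_fun_scaleR[of K 0 0] by simp

lemma support_fun_sgn:
  assumes "convex_body K"
  shows "support_fun K x = norm x * support_fun K (sgn x)"
  using support_fun_scaleR[OF assms, of "norm x" "sgn x"] by (cases "x = 0") (auto simp: assms sgn_div_norm)

lemma support_fun_singleton_zero [simp]: "support_fun {0} x = 0"
  by (simp add: support_fun_def)

lemma support_fun_cball: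
  assumes "0 \<le> r"
  shows "support_fun (cball 0 r) x = r * norm x"
proof (rule antisym)
  have "x \<bullet> y \<le> r * norm x" if "norm y \<le> r" for y
  proof -
    have "x \<bullet> y \<le> norm x * norm y"
      by (rule norm_cauchy_schwarz)
    also have "\<dots> \<le> norm x * r"
      using that by (intro mult_left_mono) auto
    finally show ?thesis by (simp add: mult.commute)
  qed
  then show "support_fun (cball 0 r) x \<le> r * norm x"
    using assms by (intro support_fun_le) auto
  have "x \<bullet> (r *\<^sub>R sgn x) \<le> support_fun (cball 0 r) x"
    using assms by (intro inner_le_support_fun) (auto simp: norm_sgn)
  moreover have "x \<bullet> (r *\<^sub>R sgn x) = r * norm x"
    by (cases "x = 0") (auto simp: sgn_div_norm dot_square_norm power2_eq_square)
  ultimately show "r * norm x \<le> support_fun (cball 0 r) x" by metis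
qed

lemma support_fun_closed_segment:
  "support_fun (closed_segment 0 v) x = max 0 (x \<bullet> v)"
proof (rule antisym)
  show "support_fun (closed_segment 0 v) x \<le> max 0 (x \<bullet> v)"
  proof (rule support_fun_le)
    fix y assume "y \<in> closed_segment 0 v"
    then obtain u where u: "0 \<le> u" "u \<le> 1" "y = u *\<^sub>R v"
      by (auto simp: in_segment)
    have "u * (x \<bullet> v) \<le> max 0 (x \<bullet> v)"
    proof (cases "x \<bullet> v \<ge> 0")
      case True
      with u show ?thesis by (simp add: mult_left_le_one_le)
    next
      case False
      with u show ?thesis by (simp add: mult_nonneg_nonpos)
    qed
    with u show "x \<bullet> y \<le> max 0 (x \<bullet> v)" by simp
  qed simp
  show "max 0 (x \<bullet> v) \<le> support_fun (closed_segment 0 v) x"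
    using inner_le_support_fun[of "closed_segment 0 v" 0 x]
      inner_le_support_fun[of "closed_segment 0 v" v x] by simp
qed

text \<open>A point outside \<open>K\<close> is strictly separated from it by a hyperplane, and
  positive homogeneity allows its normal to be scaled to a unit vector.\<close>

lemma mem_iff_support_fun:
  assumes "convex_body K"
  shows "x \<in> K \<longleftrightarrow> (\<forall>u\<in>sphere 0 1. x \<bullet> u \<le> support_fun K u)"
proof
  assume "x \<in> K"
  then show "\<forall>u\<in>sphere 0 1. x \<bullet> u \<le> support_fun K u"
    using inner_le_support_fun[OF assms] by (metis inner_commute)
next
  assume *: "\<forall>u\<in>sphere 0 1. x \<bullet> u \<le> support_fun K u"
  show "x \<in> K"
  proof (rule ccontr)
    assume "x \<notin> K"
    then obtain a b where ab: "a \<bullet> x < b" "\<And>y. y \<in> K \<Longrightarrow> a \<bullet> y > b"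
      using separating_hyperplane_closed_point[of K x] assms
      by (auto simp: convex_body_def compact_imp_closed)
    \<comment> \<open>The separation puts \<open>K\<close> on the side where \<open>a\<close> is
      large, so the outer normal is \<open>- a\<close>.\<close>
    obtain y where y: "y \<in> K" "support_fun K (- a) = - a \<bullet> y"
      using assms support_fun_attained by blast
    have less: "support_fun K (- a) < - a \<bullet> x"
      using ab(1) ab(2)[OF y(1)] y(2) by simp
    have "a \<noteq> 0"
      using less assms by auto
    then have "sgn (- a) \<in> sphere 0 1"
      by (simp add: norm_sgn)
    then have "x \<bullet> sgn (- a) \<le> support_fun K (sgn (- a))"
      using * by blast
    then have "norm a * (x \<bullet> sgn (- a)) \<le> support_fun K (- a)"
      using support_fun_sgn[OF assms, of "- a"] by (simp add: mult_left_mono)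
    moreover have "norm a * (x \<bullet> sgn (- a)) = - a \<bullet> x"
      using \<open>a \<noteq> 0\<close> by (simp add: sgn_div_norm inner_commute)
    ultimately show False
      using less by simp
  qed
qed

lemma subset_iff_support_fun:
  assumes "convex_body K" "convex_body L"
  shows "K \<subseteq> L \<longleftrightarrow> (\<forall>u\<in>sphere 0 1. support_fun K u \<le> support_fun L u)"
  using assms
  by (meson mem_iff_support_fun order_trans subset_iff support_fun_mono)

lemma convex_body_eqI:
  assumes "convex_body K" "convex_body L"
    and "\<And>u. u \<in> sphere 0 1 \<Longrightarrow> support_fun K u = support_fun L u"
  shows "K = L"
  using assms by (intro subset_antisym) (auto simp: subset_iff_support_fun)

lemma convex_body_subset_cball:
  assumes "convex_body K"
  obtains R where "0 < R" "K \<subseteq> cball 0 R"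
  using assms bounded_pos unfolding convex_body_def
  by (metis compact_imp_bounded mem_cball_0 subsetI)

lemma support_fun_bounded:
  assumes "convex_body K" "K \<subseteq> cball 0 R"
  shows "support_fun K x \<le> R * norm x"
proof (rule support_fun_le[OF assms(1)])
  fix y assume "y \<in> K"
  then have "norm y \<le> R" using assms by auto
  then show "x \<bullet> y \<le> R * norm x"
    by (metis mult.commute mult_left_mono norm_cauchy_schwarz norm_ge_zero order_trans)
qed

text \<open>Subadditivity bounds an increment by h_K(x - y), so the radius of a ball about the
  origin containing \<open>K\<close> is a Lipschitz constant.\<close>

lemma continuous_on_support_fun:
  assumes "convex_body K"
  shows "continuous_on S (support_fun K)"
proof -
  obtain R where R: "0 < R" "K \<subseteq> cball 0 R"
    using assms by (rule convex_body_subset_cball)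
  have *: "support_fun K x \<le> support_fun K y + R * dist x y" for x y
  proof -
    obtain z where z: "z \<in> K" "support_fun K x = x \<bullet> z"
      using assms support_fun_attained by blast
    have "x \<bullet> z = y \<bullet> z + (x - y) \<bullet> z"
      by (simp add: inner_diff_left)
    also have "y \<bullet> z \<le> support_fun K y"
      by (rule inner_le_support_fun[OF assms z(1)])
    also have "(x - y) \<bullet> z \<le> support_fun K (x - y)"
      by (rule inner_le_support_fun[OF assms z(1)])
    also have "\<dots> \<le> R * dist x y"
      using support_fun_bounded[OF assms R(2)] by (simp add: dist_norm)
    finally show ?thesis using z by simp
  qed
  have "R-lipschitz_on S (support_fun K)"
  proof (rule lipschitz_onI)
    fix x y
    show "dist (support_fun K x) (support_fun K y) \<le> R * dist x y"
      using *[of x y] *[of y x] by (simp add: dist_real_def dist_commute abs_le_iff)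
  qed (use R in simp)
  then show ?thesis
    by (rule lipschitz_on_continuous_on)
qed

section \<open>Sums with zonotopes\<close>

text \<open>The Jensen equation \<open>mid\<close> makes \<open>g\<close> additive; monotonicity
  then excludes the wild solutions of Cauchy's equation.\<close>

lemma nonneg_midpoint_affine:
  fixes f :: "real \<Rightarrow> real"
  assumes mono: "\<And>s t. 0 \<le> s \<Longrightarrow> s \<le> t \<Longrightarrow> f s \<le> f t"
    and mid: "\<And>s t. 0 \<le> s \<Longrightarrow> s \<le> t \<Longrightarrow> f (t + s) + f (t - s) = 2 * f t"
    and "0 \<le> t"
  shows "f t = f 0 + t * (f 1 - f 0)"
proof -
  define g where "g t = f t - f 0" for t
  have g_half: "2 * g (t / 2) = g t" if "0 \<le> t" for t
    using mid[of "t / 2" "t / 2"] that by (simp add: g_def)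
  have g_add_le: "g (a + b) = g a + g b" if "0 \<le> b" "b \<le> a" for a b
  proof -
    have "f ((a + b) / 2 + (a - b) / 2) + f ((a + b) / 2 - (a - b) / 2) = 2 * f ((a + b) / 2)"
      using that by (intro mid) auto
    moreover have "(a + b) / 2 + (a - b) / 2 = a" "(a + b) / 2 - (a - b) / 2 = b"
      by (simp_all add: field_simps)
    ultimately show ?thesis
      using g_half[of "a + b"] that by (simp add: g_def)
  qed
  have g_add: "g (a + b) = g a + g b" if "0 \<le> a" "0 \<le> b" for a b
    using g_add_le[of a b] g_add_le[of b a] that by (cases "a \<le> b") (auto simp: add.commute)
  have g_mult: "g (of_nat k * x) = of_nat k * g x" if "0 \<le> x" for k x
  proof (induction k)
    case 0
    show ?case by (simp add: g_def)
  next
    case (Suc k)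
    then show ?case
      using g_add[of x "of_nat k * x"] that by (simp add: algebra_simps)
  qed
  have g_mono: "g a \<le> g b" if "0 \<le> a" "a \<le> b" for a b
    using mono[OF that] by (simp add: g_def)
  have g1: "0 \<le> g 1"
    using g_mono[of 0 1] by (simp add: g_def)
  \<comment> \<open>As \<open>k t\<close> lies between the integers \<open>m\<close> and
    \<open>m + 1\<close>, both \<open>g (k t)\<close> and \<open>k t g(1)\<close> lie between
    \<open>m g(1)\<close> and \<open>(m + 1) g(1)\<close>. Letting \<open>k\<close> grow forces the
    difference to vanish.\<close>
  have bound: "of_nat k * \<bar>g t - t * g 1\<bar> \<le> g 1" for k
  proof -
    define m where "m = nat \<lfloor>of_nat k * t\<rfloor>"
    have m: "of_nat m \<le> of_nat k * t" "of_nat k * t \<le> of_nat (Suc m)"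
      using \<open>0 \<le> t\<close> unfolding m_def by (simp_all add: of_nat_nat) linarith
    have "of_nat m * g 1 \<le> of_nat k * g t"
      using g_mono[OF _ m(1)] g_mult[of 1 m] g_mult[OF \<open>0 \<le> t\<close>, of k] by simp
    moreover have "of_nat k * g t \<le> of_nat (Suc m) * g 1"
      using g_mono[OF _ m(2)] g_mult[of 1 "Suc m"] g_mult[OF \<open>0 \<le> t\<close>, of k] \<open>0 \<le> t\<close> by simp
    moreover have "of_nat m * g 1 \<le> of_nat k * t * g 1" "of_nat k * t * g 1 \<le> of_nat (Suc m) * g 1"
      using m g1 by (auto intro: mult_right_mono simp del: of_nat_Suc)
    ultimately have "\<bar>of_nat k * g t - of_nat k * t * g 1\<bar> \<le> g 1"
      by (simp add: algebra_simps abs_le_iff)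
    also have "of_nat k * g t - of_nat k * t * g 1 = of_nat k * (g t - t * g 1)"
      by (simp add: algebra_simps)
    finally show ?thesis
      by (simp add: abs_mult)
  qed
  have "\<bar>g t - t * g 1\<bar> = 0"
  proof (rule ccontr)
    assume "\<bar>g t - t * g 1\<bar> \<noteq> 0"
    then obtain k where "g 1 < of_nat k * \<bar>g t - t * g 1\<bar>"
      using ex_less_of_nat_mult[of "\<bar>g t - t * g 1\<bar>" "g 1"] by auto
    with bound[of k] show False by simp
  qed
  then show ?thesis by (simp add: g_def)
qed

section \<open>Minkowski sums with a segment\<close>

lemma closed_segment_0_scaleR:
  assumes "0 \<le> t"
  shows "closed_segment 0 (t *\<^sub>R v) = (\<lambda>a. a *\<^sub>R v) ` {0..t}"
proof -
  have "\<exists>u. 0 \<le> u \<and> u \<le> 1 \<and> a *\<^sub>R v = (u * t) *\<^sub>R v" if "0 \<le> a" "a \<le> t" for a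
    using that by (intro exI[of _ "a / t"]) (auto simp: field_simps)
  then show ?thesis
    using assms by (fastforce simp: in_segment mult_left_le_one_le)
qed

lemma mem_plus_closed_segment:
  assumes "0 \<le> t"
  shows "x \<in> K + closed_segment 0 (t *\<^sub>R v) \<longleftrightarrow> (\<exists>a\<in>{0..t}. x - a *\<^sub>R v \<in> K)"
  unfolding closed_segment_0_scaleR[OF assms]
proof
  assume "x \<in> K + (\<lambda>a. a *\<^sub>R v) ` {0..t}"
  then obtain y a where "y \<in> K" "a \<in> {0..t}" "x = y + a *\<^sub>R v"
    by (auto simp: set_plus_def)
  then show "\<exists>a\<in>{0..t}. x - a *\<^sub>R v \<in> K"
    by (intro bexI[of _ a]) auto
next
  assume "\<exists>a\<in>{0..t}. x - a *\<^sub>R v \<in> K"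
  then obtain a where "a \<in> {0..t}" "x - a *\<^sub>R v \<in> K"
    by blast
  then show "x \<in> K + (\<lambda>a. a *\<^sub>R v) ` {0..t}"
    using set_plus_intro[of "x - a *\<^sub>R v" K "a *\<^sub>R v" "(\<lambda>a. a *\<^sub>R v) ` {0..t}"]
    by (metis diff_add_cancel imageI)
qed

lemma lmeasurable_convex_body: "convex_body K \<Longrightarrow> K \<in> lmeasurable"
  by (simp add: convex_body_def lmeasurable_compact)

lemma measure_mono_convex_body:
  assumes "convex_body K" "convex_body L" "K \<subseteq> L"
  shows "measure lebesgue K \<le> measure lebesgue L"
  using assms by (intro measure_mono_fmeasurable) (auto simp: lmeasurable_convex_body fmeasurableD)

text \<open>
  Adding a further segment of length \<open>s\<close> adds to the body a layer whose volume does not depend on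
  the length \<open>t\<close> already present.
\<close>
lemma measure_plus_closed_segment:
  assumes K: "convex_body K" and "0 \<le> t"
  shows "measure lebesgue (K + closed_segment 0 (t *\<^sub>R v)) =
    measure lebesgue K + t * (measure lebesgue (K + closed_segment 0 v) - measure lebesgue K)"
proof -
  define A where "A t = K + closed_segment 0 (t *\<^sub>R v)" for t :: real
  have body: "convex_body (A t)" for t
    unfolding A_def using K by (intro convex_body_plus) auto
  have mem: "x \<in> A t \<longleftrightarrow> (\<exists>a\<in>{0..t}. x - a *\<^sub>R v \<in> K)" if "0 \<le> t" for x t
    unfolding A_def using that by (rule mem_plus_closed_segment)
  have mem': "x \<in> (+) (s *\<^sub>R v) ` A t \<longleftrightarrow> (\<exists>a\<in>{s..s + t}. x - a *\<^sub>R v \<in> K)" if "0 \<le> t" for x s t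
  proof -
    have "x \<in> (+) (s *\<^sub>R v) ` A t \<longleftrightarrow> x - s *\<^sub>R v \<in> A t"
      by (auto simp: image_iff intro: bexI[rotated])
    also have "\<dots> \<longleftrightarrow> (\<exists>a\<in>{0..t}. x - (a + s) *\<^sub>R v \<in> K)"
      using that by (simp add: mem algebra_simps)
    also have "\<dots> \<longleftrightarrow> (\<exists>a\<in>(\<lambda>a. a + s) ` {0..t}. x - a *\<^sub>R v \<in> K)"
      by blast
    also have "(\<lambda>a. a + s) ` {0..t} = {s..s + t}"
      by (simp add: add.commute)
    finally show ?thesis .
  qed
  \<comment> \<open>Inclusion-exclusion for \<open>A t\<close> and its translate by
    \<open>s v\<close>: the union is \<open>A (t + s)\<close> and, by convexity, the intersection is
    a translate of \<open>A (t - s)\<close>.\<close>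
  have mid: "measure lebesgue (A (t + s)) + measure lebesgue (A (t - s)) = 2 * measure lebesgue (A t)"
    if st: "0 \<le> s" "s \<le> t" for s t
  proof -
    have un: "A t \<union> (+) (s *\<^sub>R v) ` A t = A (t + s)"
    proof -
      have "(\<exists>a\<in>{0..t}. x - a *\<^sub>R v \<in> K) \<or> (\<exists>a\<in>{s..s + t}. x - a *\<^sub>R v \<in> K) \<longleftrightarrow>
          (\<exists>a\<in>{0..t + s}. x - a *\<^sub>R v \<in> K)" for x
      proof -
        have "{0..t + s} = {0..t} \<union> {s..s + t}" using st by auto
        then show ?thesis by auto
      qed
      with st show ?thesis
        by (auto simp: mem mem' set_eq_iff)
    qed
    have int: "A t \<inter> (+) (s *\<^sub>R v) ` A t = (+) (s *\<^sub>R v) ` A (t - s)"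
    proof (rule set_eqI)
      fix x
      have "(\<exists>c\<in>{s..t}. x - c *\<^sub>R v \<in> K)"
        if a: "a \<in> {0..t}" "x - a *\<^sub>R v \<in> K" and b: "b \<in> {s..s + t}" "x - b *\<^sub>R v \<in> K" for a b
      proof (cases "a \<ge> s \<or> b \<le> t")
        case True
        with a b show ?thesis by auto
      next
        case False
        \<comment> \<open>Here a < s <= t < b, and \<open>l\<close> is the weight that writes
          \<open>s\<close> as a convex combination of \<open>a\<close> and \<open>b\<close>.\<close>
        define l where "l = (s - a) / (b - a)"
        have l: "0 \<le> l" "l \<le> 1" "(1 - l) * a + l * b = s"
          using False st unfolding l_def by (auto simp: divide_simps) (simp add: algebra_simps)
        have "(1 - l) *\<^sub>R (x - a *\<^sub>R v) + l *\<^sub>R (x - b *\<^sub>R v) \<in> K"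
          using K a b l unfolding convex_body_def convex_alt by auto
        also have "(1 - l) *\<^sub>R (x - a *\<^sub>R v) + l *\<^sub>R (x - b *\<^sub>R v) = x - ((1 - l) * a + l * b) *\<^sub>R v"
          by (simp add: algebra_simps)
        finally show ?thesis using l(3) st by auto
      qed
      then show "x \<in> A t \<inter> (+) (s *\<^sub>R v) ` A t \<longleftrightarrow> x \<in> (+) (s *\<^sub>R v) ` A (t - s)"
        using st by (auto simp: mem mem')
    qed
    have "measure lebesgue (A t \<union> (+) (s *\<^sub>R v) ` A t) + measure lebesgue (A t \<inter> (+) (s *\<^sub>R v) ` A t)
        = measure lebesgue (A t) + measure lebesgue ((+) (s *\<^sub>R v) ` A t)"
      by (simp add: measure_Un3 lmeasurable_convex_body body convex_body_translation)
    then show ?thesis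
      unfolding un int by (simp add: measure_translation)
  qed
  have mono: "measure lebesgue (A s) \<le> measure lebesgue (A t)" if st: "0 \<le> s" "s \<le> t" for s t
  proof (intro measure_mono_convex_body body subsetI)
    fix x assume "x \<in> A s"
    then obtain a where "a \<in> {0..s}" "x - a *\<^sub>R v \<in> K"
      using mem[of s x] st by auto
    then show "x \<in> A t"
      using mem[of t x] st by (auto intro!: bexI[of _ a])
  qed
  have "A 0 = K" "A 1 = K + closed_segment 0 v"
    by (auto simp: A_def set_plus_def)
  then show ?thesis
    using nonneg_midpoint_affine[of "\<lambda>t. measure lebesgue (A t)", OF mono mid \<open>0 \<le> t\<close>]
    by (simp add: A_def)
qed

text \<open>A list of generators, so that volume polynomials can be built one segment at a time.
  Starting the segments at the origin turns the support function into a sum of terms max 0 (x . v),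
  to be matched with an integral of such terms.\<close>

definition zonotope :: "'a::euclidean_space list \<Rightarrow> 'a set" where
  "zonotope vs = foldr (\<lambda>v Z. closed_segment 0 v + Z) vs {0}"

lemma zonotope_Nil [simp]: "zonotope [] = {0}"
  and zonotope_Cons [simp]: "zonotope (v # vs) = closed_segment 0 v + zonotope vs"
  by (simp_all add: zonotope_def)

lemma convex_body_zonotope [simp]: "convex_body (zonotope vs)"
proof (induction vs)
  case Nil
  show ?case by (simp add: convex_body_def)
qed (simp add: convex_body_plus)

lemma support_fun_zonotope:
  "support_fun (zonotope vs) x = (\<Sum>v\<leftarrow>vs. max 0 (x \<bullet> v))"
  by (induction vs) (auto simp: support_fun_plus support_fun_closed_segment)

lemma scaleR_set_plus: "(*\<^sub>R) c ` (K + L) = (*\<^sub>R) c ` K + (*\<^sub>R) c ` L"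
  for K L :: "'a::real_vector set"
  by (force simp: set_plus_def scaleR_add_right)

lemma scaleR_closed_segment_0:
  "(*\<^sub>R) c ` closed_segment 0 v = closed_segment 0 (c *\<^sub>R v)"
  by (rule closed_segment_linear_image[of "(*\<^sub>R) c" 0 v, simplified, symmetric]) 

text \<open>The volume is affine in the length of the first segment, and its two coefficients come
  from vol(K + e Z) and vol(K + [0,v] + e Z), polynomials by induction; hence \<open>K\<close>
  varies in the induction. The recursion bounds the degree only by the number of segments.\<close>

lemma measure_plus_zonotope_poly:
  assumes "convex_body K"
  shows "\<exists>p. \<forall>e\<ge>0. measure lebesgue (K + (*\<^sub>R) e ` zonotope vs) = poly p e"
  using assms
proof (induction vs arbitrary: K)
  case Nil
  have "K + {0} = K" by (auto simp: set_plus_def)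
  then show ?case
    by (intro exI[of _ "[:measure lebesgue K:]"]) auto
next
  case (Cons v vs)
  obtain p where p: "\<forall>e\<ge>0. measure lebesgue (K + (*\<^sub>R) e ` zonotope vs) = poly p e"
    using Cons by blast
  obtain q where q: "\<forall>e\<ge>0. measure lebesgue (K + closed_segment 0 v + (*\<^sub>R) e ` zonotope vs) = poly q e"
    using Cons.IH[of "K + closed_segment 0 v"] Cons.prems by (auto simp: convex_body_plus)
  have "measure lebesgue (K + (*\<^sub>R) e ` zonotope (v # vs)) = poly (p + [:0, 1:] * (q - p)) e"
    if "0 \<le> e" for e
  proof -
    have "K + (*\<^sub>R) e ` zonotope (v # vs) = K + (*\<^sub>R) e ` zonotope vs + closed_segment 0 (e *\<^sub>R v)"
      by (simp add: scaleR_set_plus scaleR_closed_segment_0 ac_simps)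
    moreover have "K + (*\<^sub>R) e ` zonotope vs + closed_segment 0 v = K + closed_segment 0 v + (*\<^sub>R) e ` zonotope vs"
      by (simp add: ac_simps)
    ultimately show ?thesis
      using measure_plus_closed_segment[of "K + (*\<^sub>R) e ` zonotope vs" e v] that p q Cons.prems
      by (simp add: convex_body_plus convex_body_scaleR)
  qed
  then show ?case by blast
qed

section \<open>Lebesgue measure is invariant under reflections\<close>

text \<open>The reflection in the hyperplane orthogonal to \<open>w\<close>, and the identity for
  \<open>w = 0\<close>.\<close>

definition reflection :: "'a::euclidean_space \<Rightarrow> 'a \<Rightarrow> 'a" where
  "reflection w u = u - (2 * (w \<bullet> u) / (w \<bullet> w)) *\<^sub>R w"

lemma linear_reflection: "linear (reflection w)"
  unfolding reflection_def
  by (intro linearI) (auto simp: algebra_simps add_divide_distrib)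

lemma reflection_reflection [simp]: "reflection w (reflection w u) = u"
  by (cases "w = 0") (auto simp: reflection_def algebra_simps)

lemma inner_reflection: "x \<bullet> reflection w u = reflection w x \<bullet> u"
  by (simp add: reflection_def algebra_simps inner_commute)

lemma norm_reflection [simp]: "norm (reflection w u) = norm u"
  by (simp add: norm_eq_sqrt_inner inner_reflection)

text \<open>Equal norms give 2 (a - b) . a = |a - b|^2, so the coefficient in the reflection is
  1.\<close>

lemma reflection_swap:
  assumes "norm a = norm b"
  shows "reflection (a - b) a = b"
proof (cases "a = b")
  case False
  have "2 * ((a - b) \<bullet> a) = (a - b) \<bullet> (a - b)"
    using assms by (simp add: norm_eq algebra_simps inner_commute)
  with False show ?thesis by (simp add: reflection_def)
qed (simp add: reflection_def)

lemma measurable_reflection [measurable]: "reflection w \<in> borel_measurable borel"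
  by (intro borel_measurable_continuous_onI linear_continuous_on linear_reflection
      linear_conv_bounded_linear[THEN iffD1])

text \<open>
  Fubini's theorem identifies any translation-invariant measure with Lebesgue measure up to a
  factor; the factor is determined on the unit ball, which the reflection fixes.
\<close>
lemma distr_lborel_reflection:
  fixes w :: "'a::euclidean_space"
  shows "distr lborel borel (reflection w) = lborel"
proof (rule measure_eqI)
  let ?T = "reflection w"
  show "sets (distr lborel borel ?T) = sets lborel" by simp
  have transl: "(\<integral>\<^sup>+x. f (x + c) \<partial>lborel) = (\<integral>\<^sup>+x. f x \<partial>lborel)"
    if [measurable]: "f \<in> borel_measurable borel" for f :: "'a \<Rightarrow> ennreal" and c
    by (subst (2) lborel_affine[of 1 c])
      (auto simp: nn_integral_density nn_integral_distr add.commute)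
  have neg: "(\<integral>\<^sup>+x. f (- x) \<partial>lborel) = (\<integral>\<^sup>+x. f x \<partial>lborel)"
    if [measurable]: "f \<in> borel_measurable borel" for f :: "'a \<Rightarrow> ennreal"
    by (subst (2) lborel_affine[of "-1" 0])
      (auto simp: nn_integral_density nn_integral_distr)
  fix A :: "'a set" assume "A \<in> sets (distr lborel borel ?T)"
  then have A [measurable]: "A \<in> sets borel" by simp
  define f g :: "'a \<Rightarrow> ennreal" where "f = indicator A" and "g = indicator (cball 0 1)"
  have [measurable]: "f \<in> borel_measurable borel" "g \<in> borel_measurable borel"
    unfolding f_def g_def by (auto intro: borel_measurable_indicator)
  define F where "F = (\<integral>\<^sup>+x. f (?T x) \<partial>lborel)"
  \<comment> \<open>In the double integral of f(T x) g(y), shift \<open>y\<close> by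
    \<open>T x\<close> and then \<open>x\<close> by \<open>- T y\<close>. The integrand becomes f(T
    x - y) g(T x), whose integral over \<open>y\<close> separates from \<open>x\<close>.\<close>
  have "F * (\<integral>\<^sup>+y. g y \<partial>lborel) = (\<integral>\<^sup>+x. \<integral>\<^sup>+y. f (?T x) * g y \<partial>lborel \<partial>lborel)"
    by (simp add: F_def nn_integral_cmult nn_integral_multc)
  also have "\<dots> = (\<integral>\<^sup>+x. \<integral>\<^sup>+y. f (?T x) * g (y + ?T x) \<partial>lborel \<partial>lborel)"
    by (simp add: nn_integral_cmult transl)
  also have "\<dots> = (\<integral>\<^sup>+y. \<integral>\<^sup>+x. f (?T x) * g (y + ?T x) \<partial>lborel \<partial>lborel)"
    by (rule lborel_pair.Fubini'[symmetric]) measurable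
  also have "\<dots> = (\<integral>\<^sup>+y. \<integral>\<^sup>+x. f (?T x - y) * g (?T x) \<partial>lborel \<partial>lborel)"
  proof (rule nn_integral_cong)
    fix y
    have "(\<integral>\<^sup>+x. f (?T (x + - ?T y)) * g (y + ?T (x + - ?T y)) \<partial>lborel) =
        (\<integral>\<^sup>+x. f (?T x) * g (y + ?T x) \<partial>lborel)"
      by (rule transl) measurable
    moreover have "?T (x + - ?T y) = ?T x - y" for x
      by (simp only: linear_diff[OF linear_reflection] diff_conv_add_uminus[symmetric] reflection_reflection)
    ultimately show "(\<integral>\<^sup>+x. f (?T x) * g (y + ?T x) \<partial>lborel) =
        (\<integral>\<^sup>+x. f (?T x - y) * g (?T x) \<partial>lborel)"
      by simp
  qed
  also have "\<dots> = (\<integral>\<^sup>+x. \<integral>\<^sup>+y. f (?T x - y) * g (?T x) \<partial>lborel \<partial>lborel)"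
    by (rule lborel_pair.Fubini') measurable
  also have "\<dots> = (\<integral>\<^sup>+x. (\<integral>\<^sup>+y. f y \<partial>lborel) * g x \<partial>lborel)"
  proof (rule nn_integral_cong)
    fix x
    have "(\<integral>\<^sup>+y. f (?T x - y) \<partial>lborel) = (\<integral>\<^sup>+y. f (y + ?T x) \<partial>lborel)"
      using neg[of "\<lambda>y. f (y + ?T x)"] by (simp add: algebra_simps)
    also have "\<dots> = (\<integral>\<^sup>+y. f y \<partial>lborel)"
      by (rule transl) measurable
    \<comment> \<open>\<open>g\<close> is the indicator of a ball about the origin and
      \<open>T\<close> preserves norms, so g(T x) = g(x).\<close>
    finally show "(\<integral>\<^sup>+y. f (?T x - y) * g (?T x) \<partial>lborel) = (\<integral>\<^sup>+y. f y \<partial>lborel) * g x"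
      by (simp add: nn_integral_multc g_def indicator_def)
  qed
  also have "\<dots> = (\<integral>\<^sup>+y. f y \<partial>lborel) * (\<integral>\<^sup>+y. g y \<partial>lborel)"
    by (simp add: nn_integral_cmult)
  finally have eq: "F * emeasure lborel (cball (0::'a) 1) = emeasure lborel A * emeasure lborel (cball (0::'a) 1)"
    by (simp add: f_def g_def)
  have "emeasure lborel (cball (0::'a) 1) \<noteq> 0" "emeasure lborel (cball (0::'a) 1) \<noteq> top"
    using unit_ball_vol_pos[of "real DIM('a)", THEN less_imp_neq, symmetric]
    by (simp_all add: emeasure_cball)
  then have "F = emeasure lborel A"
    using eq by (auto simp: ennreal_mult_cancel_left mult.commute[of _ "emeasure lborel (cball (0::'a) 1)"])
  moreover have "F = emeasure (distr lborel borel ?T) A"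
  proof -
    have "emeasure (distr lborel borel ?T) A = (\<integral>\<^sup>+x. f x \<partial>distr lborel borel ?T)"
      by (simp add: f_def)
    also have "\<dots> = F"
      unfolding F_def by (rule nn_integral_distr) auto
    finally show ?thesis ..
  qed
  ultimately show "emeasure (distr lborel borel ?T) A = emeasure lborel A"
    by simp
qed

section \<open>The ball as a limit of zonotopes\<close>

lemma integrable_continuous_cball:
  fixes f :: "'a::euclidean_space \<Rightarrow> real"
  assumes "continuous_on UNIV f"
  shows "set_integrable lborel (cball a r) f"
  unfolding set_integrable_def using assms
  by (intro borel_integrable_compact) (auto intro: continuous_on_subset)

text \<open>The reflection exchanging \<open>x\<close> and \<open>y\<close> preserves the measure
  and is self-adjoint, so it passes from the integration variable to \<open>x\<close>.\<close>

lemma integral_ball_max_inner_isotropic: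
  fixes x y :: "'a::euclidean_space"
  assumes "norm x = norm y"
  shows "(LINT u:cball 0 1|lborel. max 0 (x \<bullet> u)) = (LINT u:cball 0 1|lborel. max 0 (y \<bullet> u))"
proof -
  let ?T = "reflection (x - y)"
  have "(LINT u:cball 0 1|lborel. max 0 (x \<bullet> u)) =
      (LINT u|distr lborel borel ?T. indicator (cball 0 1) u *\<^sub>R max 0 (x \<bullet> u))"
    by (simp add: distr_lborel_reflection set_lebesgue_integral_def)
  also have "\<dots> = (LINT u|lborel. indicator (cball 0 1) (?T u) *\<^sub>R max 0 (x \<bullet> ?T u))"
  proof (rule integral_distr)
    have "(\<lambda>u. max 0 (x \<bullet> u)) \<in> borel_measurable borel"
      by (intro borel_measurable_continuous_onI continuous_intros)
    then show "(\<lambda>u. indicat_real (cball 0 1) u *\<^sub>R max 0 (x \<bullet> u)) \<in> borel_measurable borel"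
      by (intro borel_measurable_scaleR borel_measurable_indicator) auto
  qed simp
  also have "\<dots> = (LINT u:cball 0 1|lborel. max 0 (y \<bullet> u))"
    using reflection_swap[OF assms]
    by (simp add: set_lebesgue_integral_def inner_reflection indicator_def)
  finally show ?thesis .
qed

text \<open>Continuity is asked only near \<open>a\<close>, because a later integrand is a function
  of \<open>sgn x\<close>, which jumps at the origin.\<close>

lemma integral_pos_continuous:
  fixes f :: "'a::euclidean_space \<Rightarrow> real"
  assumes cont: "continuous_on (ball a r) f" and int: "set_integrable lborel S f"
    and nonneg: "\<And>x. x \<in> S \<Longrightarrow> 0 \<le> f x" and "ball a r \<subseteq> S" "0 < r" "0 < f a"
    and S: "S \<in> sets borel"
  shows "0 < (LINT x:S|lborel. f x)"
proof -
  have "\<exists>d>0. \<forall>x\<in>ball a r. dist x a < d \<longrightarrow> dist (f x) (f a) < f a / 2"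
    using cont \<open>0 < r\<close> \<open>0 < f a\<close> unfolding continuous_on_iff by (metis centre_in_ball half_gt_zero)
  then obtain d where d: "0 < d" "\<And>x. x \<in> ball a r \<Longrightarrow> dist x a < d \<Longrightarrow> dist (f x) (f a) < f a / 2"
    by blast
  define e where "e = min d r"
  have e: "0 < e" "ball a e \<subseteq> S" using d \<open>0 < r\<close> \<open>ball a r \<subseteq> S\<close> by (auto simp: e_def)
  have lower: "f a / 2 \<le> f x" if "x \<in> ball a e" for x
    using d(2)[of x] that unfolding e_def dist_real_def abs_less_iff by (auto simp: dist_commute)
  have "0 < f a / 2 * measure lborel (ball a e)"
    using e \<open>0 < f a\<close> by (simp add: content_ball_pos)
  also have "\<dots> = (LINT x:ball a e|lborel. f a / 2)"
    by (simp add: set_lebesgue_integral_def mult.commute)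
  also have "\<dots> \<le> (LINT x:S|lborel. f x)"
    unfolding set_lebesgue_integral_def
  proof (rule integral_mono)
    show "integrable lborel (\<lambda>x. indicat_real S x *\<^sub>R f x)"
      using int by (simp add: set_integrable_def)
    show "integrable lborel (\<lambda>x. indicat_real (ball a e) x *\<^sub>R (f a / 2))"
      by (auto simp: emeasure_ball e less_imp_le)
  qed (use e lower nonneg in \<open>auto simp: indicator_def\<close>)
  finally show ?thesis .
qed

text \<open>By isotropy the integral depends only on the norm of \<open>x\<close>, by homogeneity
  linearly. Positivity is seen at e/2, where the integrand is 1/2.\<close>

lemma integral_ball_max_inner:
  obtains c where "0 < c"
    "\<And>x::'a::euclidean_space. (LINT u:cball 0 1|lborel. max 0 (x \<bullet> u)) = c * norm x"
proof -
  obtain e :: 'a where e: "e \<in> Basis"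
    using nonempty_Basis by blast
  let ?c = "LINT u:cball 0 1|lborel. max 0 (e \<bullet> u)"
  have "0 < ?c"
  proof (rule integral_pos_continuous)
    show "set_integrable lborel (cball 0 1) (\<lambda>u. max 0 (e \<bullet> u))"
      by (intro integrable_continuous_cball continuous_intros)
    show "ball (e /\<^sub>R 2) (1/2) \<subseteq> cball 0 1"
    proof
      fix x assume "x \<in> ball (e /\<^sub>R 2) (1/2)"
      then have "norm (x - e /\<^sub>R 2) < 1/2" by (simp add: dist_norm norm_minus_commute)
      moreover have "norm x \<le> norm (x - e /\<^sub>R 2) + norm (e /\<^sub>R 2)"
        using norm_triangle_ineq[of "x - e /\<^sub>R 2" "e /\<^sub>R 2"] by simp
      ultimately show "x \<in> cball 0 1" using e by simp
    qed
  qed (use e in \<open>auto intro!: continuous_intros\<close>)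
  moreover have "(LINT u:cball 0 1|lborel. max 0 (x \<bullet> u)) = ?c * norm x" for x :: 'a
  proof -
    have "(LINT u:cball 0 1|lborel. max 0 (x \<bullet> u)) = (LINT u:cball 0 1|lborel. max 0 ((norm x *\<^sub>R e) \<bullet> u))"
      by (rule integral_ball_max_inner_isotropic) (use e in simp)
    also have "\<dots> = (LINT u:cball 0 1|lborel. norm x * max 0 (e \<bullet> u))"
      by (intro arg_cong2[where f="set_lebesgue_integral lborel"] ext refl)
        (simp add: max_mult_distrib_left)
    also have "\<dots> = ?c * norm x"
      by simp
    finally show ?thesis .
  qed
  ultimately show ?thesis using that by blast
qed

text \<open>A Riemann sum with one generator per cell. On a cell inside \<open>ball y d\<close>,
  replacing \<open>u\<close> by \<open>y\<close> changes the integrand by at most d |x|. The cells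
  do not depend on \<open>x\<close>, so one list serves all \<open>x\<close>.\<close>

lemma integral_max_inner_approx:
  fixes F :: "'a::euclidean_space set"
  assumes "finite F" "S \<in> sets borel" "bounded S" "S \<subseteq> (\<Union>y\<in>F. ball y d)"
  shows "\<exists>vs. \<forall>x. \<bar>(LINT u:S|lborel. max 0 (x \<bullet> u)) - (\<Sum>v\<leftarrow>vs. max 0 (x \<bullet> v))\<bar>
    \<le> d * norm x * measure lborel S"
  using assms
proof (induction F arbitrary: S)
  case empty
  then show ?case by (intro exI[of _ "[]"]) (auto simp: set_lebesgue_integral_def)
next
  case (insert y F)
  define A B where "A = S \<inter> ball y d" and "B = S - ball y d"
  have [measurable]: "S \<in> sets borel" by fact
  have AB: "A \<in> sets borel" "B \<in> sets borel" "bounded A" "bounded B" "S = A \<union> B" "A \<inter> B = {}"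
    using insert.prems by (auto simp: A_def B_def bounded_Int bounded_diff)
  obtain vs where vs: "\<And>x. \<bar>(LINT u:B|lborel. max 0 (x \<bullet> u)) - (\<Sum>v\<leftarrow>vs. max 0 (x \<bullet> v))\<bar>
    \<le> d * norm x * measure lborel B"
  proof -
    have "B \<subseteq> (\<Union>y\<in>F. ball y d)"
      using insert.prems(3) unfolding B_def by blast
    then show ?thesis
      using insert.IH[of B] AB that by blast
  qed
  have fin: "emeasure lborel T < top" if "bounded T" for T :: "'a set"
    using emeasure_bounded_finite[OF that] by simp
  have int: "set_integrable lborel T (\<lambda>u. max 0 (x \<bullet> u))" if T: "T \<in> sets borel" "bounded T" for T and x :: 'a
  proof -
    obtain r where "\<forall>u\<in>T. norm u \<le> r"
      using \<open>bounded T\<close> unfolding bounded_iff by blast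
    then have "T \<subseteq> cball 0 r"
      by auto
    then show ?thesis
      using set_integrable_subset[OF integrable_continuous_cball[of "\<lambda>u. max 0 (x \<bullet> u)" 0 r], of T] T(1)
      by (simp add: continuous_intros)
  qed
  have intc: "set_integrable lborel T (\<lambda>u. c)" if T: "T \<in> sets borel" "bounded T" for T :: "'a set" and c :: real
    using T fin[of T] by (auto simp: set_integrable_def)
  \<comment> \<open>The weight of the cell goes into the vector, since max 0 (x . v) is positively
    homogeneous in \<open>v\<close>.\<close>
  define v where "v = measure lborel A *\<^sub>R y"
  have A: "\<bar>(LINT u:A|lborel. max 0 (x \<bullet> u)) - max 0 (x \<bullet> v)\<bar> \<le> d * norm x * measure lborel A" for x
  proof -
    have const: "(LINT u:A|lborel. c) = c * measure lborel A" for c :: real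
      using AB by (simp add: set_lebesgue_integral_def mult.commute)
    have "(LINT u:A|lborel. max 0 (x \<bullet> u)) - max 0 (x \<bullet> v)
        = (LINT u:A|lborel. max 0 (x \<bullet> u)) - (LINT u:A|lborel. max 0 (x \<bullet> y))"
    proof -
      have "max 0 (x \<bullet> v) = measure lborel A * max 0 (x \<bullet> y)"
        by (simp add: v_def max_mult_distrib_left)
      then show ?thesis by (simp add: const)
    qed
    also have "\<dots> = (LINT u:A|lborel. max 0 (x \<bullet> u) - max 0 (x \<bullet> y))"
      by (rule set_integral_diff(2)[symmetric, OF int[OF AB(1,3)] intc[OF AB(1,3)]])
    also have "\<bar>\<dots>\<bar> \<le> (LINT u:A|lborel. \<bar>max 0 (x \<bullet> u) - max 0 (x \<bullet> y)\<bar>)"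
      using set_integral_norm_bound[OF set_integral_diff(1)[OF int[OF AB(1,3)] intc[OF AB(1,3)]]]
      by simp
    also have "\<dots> \<le> (LINT u:A|lborel. d * norm x)"
    proof (rule set_integral_mono)
      show "set_integrable lborel A (\<lambda>u. \<bar>max 0 (x \<bullet> u) - max 0 (x \<bullet> y)\<bar>)"
        by (intro set_integrable_abs set_integral_diff(1) int intc AB)
      show "set_integrable lborel A (\<lambda>u. d * norm x)" by (intro intc AB)
      fix u assume "u \<in> A"
      then have "norm (u - y) \<le> d" by (auto simp: A_def dist_norm norm_minus_commute)
      have "\<bar>max 0 (x \<bullet> u) - max 0 (x \<bullet> y)\<bar> \<le> \<bar>x \<bullet> (u - y)\<bar>"
        unfolding inner_diff_right by linarith
      also have "\<dots> \<le> norm x * norm (u - y)"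
        by (rule Cauchy_Schwarz_ineq2)
      also have "\<dots> \<le> norm x * d"
        using \<open>norm (u - y) \<le> d\<close> by (intro mult_left_mono) auto
      finally show "\<bar>max 0 (x \<bullet> u) - max 0 (x \<bullet> y)\<bar> \<le> d * norm x" by (simp add: mult.commute)
    qed
    finally show ?thesis unfolding const .
  qed
  have "\<bar>(LINT u:S|lborel. max 0 (x \<bullet> u)) - (\<Sum>v\<leftarrow>v # vs. max 0 (x \<bullet> v))\<bar> \<le> d * norm x * measure lborel S" for x
  proof -
    have "(LINT u:S|lborel. max 0 (x \<bullet> u)) = (LINT u:A|lborel. max 0 (x \<bullet> u)) + (LINT u:B|lborel. max 0 (x \<bullet> u))"
      unfolding \<open>S = A \<union> B\<close> by (intro set_integral_Un AB int)
    moreover have "measure lborel S = measure lborel A + measure lborel B"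
      unfolding \<open>S = A \<union> B\<close> using AB fin by (intro measure_Union) (auto simp: top.not_eq_extremum)
    then have "d * norm x * measure lborel S = d * norm x * measure lborel A + d * norm x * measure lborel B"
      by (simp add: distrib_left)
    ultimately show ?thesis
      using A[of x] vs[of x] unfolding list.map sum_list.Cons by linarith
  qed
  then show ?case by blast
qed

text \<open>The ball is a zonoid: its support function is an average of the functions \<open>max 0 (x \<bullet> u)\<close>.\<close>
lemma zonotope_approximates_cball:
  fixes e :: real
  assumes "0 < e"
  obtains vs :: "'a::euclidean_space list" where
    "cball 0 (1 - e) \<subseteq> zonotope vs" "zonotope vs \<subseteq> cball 0 (1 + e)"
proof -
  obtain c where c: "0 < c"
    "\<And>x::'a. (LINT u:cball 0 1|lborel. max 0 (x \<bullet> u)) = c * norm x"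
    using integral_ball_max_inner by blast
  define m where "m = measure lborel (cball (0::'a) 1)"
  have "0 < m" by (simp add: m_def content_cball)
  \<comment> \<open>Chosen so that the error d |x| m equals e c |x|, which is e |x| after division
    by \<open>c\<close>.\<close>
  define d where "d = e * c / m"
  have "0 < d" using c(1) \<open>0 < m\<close> assms by (simp add: d_def)
  obtain F :: "'a set" where F: "finite F" "cball 0 1 \<subseteq> (\<Union>y\<in>F. ball y d)"
    using compact_eq_totally_bounded[of "cball (0::'a) 1"] \<open>0 < d\<close> compact_cball by metis
  obtain vs where vs: "\<And>x::'a. \<bar>c * norm x - (\<Sum>v\<leftarrow>vs. max 0 (x \<bullet> v))\<bar> \<le> d * norm x * m"
    using integral_max_inner_approx[OF F(1) _ _ F(2)] unfolding c(2) m_def by auto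
  \<comment> \<open>Dividing by \<open>c\<close> makes the approximated function |x|, the support
    function of the unit ball.\<close>
  define ws where "ws = map (\<lambda>v. v /\<^sub>R c) vs"
  have supp: "support_fun (zonotope ws) x = (\<Sum>v\<leftarrow>vs. max 0 (x \<bullet> v)) / c" for x
    unfolding ws_def support_fun_zonotope using \<open>0 < c\<close>
    by (induction vs) (auto simp: max_def divide_simps zero_le_mult_iff)
  have dm: "d * m = e * c" using \<open>0 < m\<close> by (simp add: d_def)
  have h: "\<bar>norm x - support_fun (zonotope ws) x\<bar> \<le> e * norm x" for x
  proof -
    have "c * \<bar>norm x - support_fun (zonotope ws) x\<bar> = \<bar>c * norm x - (\<Sum>v\<leftarrow>vs. max 0 (x \<bullet> v))\<bar>"
      using supp[of x] \<open>0 < c\<close> by (simp add: abs_mult_pos' right_diff_distrib)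
    also have "\<dots> \<le> (d * m) * norm x"
      using vs[of x] by (simp add: ac_simps)
    also have "\<dots> = c * (e * norm x)"
      using dm by simp
    finally show ?thesis
      using \<open>0 < c\<close> by simp
  qed
  have sphere: "\<bar>1 - support_fun (zonotope ws) u\<bar> \<le> e" if "u \<in> sphere 0 1" for u
    using h[of u] that by simp
  show ?thesis
  proof (rule that)
    show "zonotope ws \<subseteq> cball 0 (1 + e)"
      using sphere assms unfolding abs_le_iff
      by (subst subset_iff_support_fun) (force simp: support_fun_cball)+
    show "cball 0 (1 - e) \<subseteq> zonotope ws"
    \<comment> \<open>For e > 1 the inner ball has negative radius and is empty.\<close>
    proof (cases "e \<le> 1")
      case True
      then show ?thesis
        using sphere unfolding abs_le_iff
        by (subst subset_iff_support_fun) (force simp: support_fun_cball)+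
    qed simp
  qed
qed

section \<open>The Steiner polynomial\<close>

text \<open>If the degree exceeded \<open>n\<close>, then sgn(lead) p - C x^n would have a positive
  leading coefficient and be positive for large x, against the bound.\<close>

lemma degree_le_of_growth:
  fixes p :: "real poly"
  assumes "\<And>x. 1 \<le> x \<Longrightarrow> \<bar>poly p x\<bar> \<le> C * x ^ n"
  shows "degree p \<le> n"
proof (rule ccontr)
  assume "\<not> degree p \<le> n"
  then have deg: "n < degree p" by simp
  define q where "q = smult (sgn (lead_coeff p)) p"
  define r where "r = q + monom (- C) n"
  have lc: "lead_coeff p \<noteq> 0" using deg by auto
  have "degree q = degree p" using lc by (simp add: q_def sgn_zero_iff)
  moreover have "degree (monom (- C) n) < degree p"
    using deg degree_monom_le[of "- C" n] by simp
  ultimately have "lead_coeff r = lead_coeff q"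
    unfolding r_def by (metis add.commute lead_coeff_add_le)
  also have "\<dots> = \<bar>lead_coeff p\<bar>"
    using lc \<open>degree q = degree p\<close> by (simp add: q_def abs_sgn mult.commute)
  finally have "0 < lead_coeff r" using lc by simp
  then obtain m where m: "\<And>x. m \<le> x \<Longrightarrow> lead_coeff r \<le> poly r x"
    using poly_pinfty_gt_lc by blast
  let ?x = "max 1 m"
  have "0 < poly r ?x" using m[of ?x] \<open>0 < lead_coeff r\<close> by simp
  then have "C * ?x ^ n < sgn (lead_coeff p) * poly p ?x"
    by (simp add: r_def q_def poly_monom)
  also have "\<dots> \<le> \<bar>poly p ?x\<bar>"
    by (auto simp: sgn_if abs_if)
  finally show False using assms[of ?x] by simp
qed

text \<open>A polynomial of degree at most \<open>n\<close> depends linearly on its values at 0,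
  ..., n, with fixed basis polynomials; through this, pointwise limits become limits of
  polynomials.\<close>

lemma lagrange_interpolation:
  obtains L :: "nat \<Rightarrow> real poly" where "\<And>i. i \<le> n \<Longrightarrow> degree (L i) \<le> n"
    "\<And>p. degree p \<le> n \<Longrightarrow> p = (\<Sum>i\<le>n. smult (poly p (real i)) (L i))"
proof -
  define L where "L i = (\<Prod>j\<in>{..n} - {i}. smult (1 / (real i - real j)) [:- real j, 1:])" for i
  have deg: "degree (L i) \<le> n" if "i \<le> n" for i
  proof -
    have "degree (L i) \<le> (\<Sum>j\<in>{..n} - {i}. degree (smult (1 / (real i - real j)) [:- real j, 1:]))"
      unfolding L_def by (rule degree_prod_sum_le[unfolded o_def]) simp
    also have "\<dots> \<le> (\<Sum>j\<in>{..n} - {i}. 1)"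
      by (intro sum_mono) (simp add: degree_smult_eq)
    also have "\<dots> = n" using that by simp
    finally show ?thesis .
  qed
  have delta: "poly (L i) (real k) = (if i = k then 1 else 0)" if "k \<le> n" for i k
  proof (cases "i = k")
    case True
    then show ?thesis by (auto simp: L_def poly_prod intro!: prod.neutral simp: diff_divide_distrib[symmetric] field_simps)
  next
    case False
    then have "k \<in> {..n} - {i}" using that by simp
    then have "(\<Prod>j\<in>{..n} - {i}. poly (smult (1 / (real i - real j)) [:- real j, 1:]) (real k)) = 0"
      by (intro prod_zero) (auto intro!: bexI[of _ k])
    with False show ?thesis by (simp add: L_def poly_prod)
  qed
  have "p = (\<Sum>i\<le>n. smult (poly p (real i)) (L i))" if "degree p \<le> n" for p
  proof (rule poly_eqI_degree[where A = "real ` {..n}"])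
    fix x assume "x \<in> real ` {..n}"
    then obtain k where k: "k \<le> n" "x = real k" by auto
    then show "poly p x = poly (\<Sum>i\<le>n. smult (poly p (real i)) (L i)) x"
      by (simp add: poly_sum delta mult_delta_right)
  next
    have "degree (\<Sum>i\<le>n. smult (poly p (real i)) (L i)) \<le> n"
      by (intro degree_sum_le) (auto intro: order.trans[OF degree_smult_le] deg)
    then show "degree (\<Sum>i\<le>n. smult (poly p (real i)) (L i)) < card (real ` {..n})"
      by (simp add: card_image)
  qed (use that in \<open>simp add: card_image\<close>)
  with deg that show ?thesis by blast
qed

text \<open>Convergence at the interpolation nodes 0, ..., n determines the limit polynomial; the
  nodes lie in the half-line where convergence is assumed.\<close>

lemma pointwise_limit_poly:
  fixes p :: "nat \<Rightarrow> real poly" and f :: "real \<Rightarrow> real"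
  assumes deg: "\<And>k. degree (p k) \<le> n"
    and lim: "\<And>x. 0 \<le> x \<Longrightarrow> (\<lambda>k. poly (p k) x) \<longlonglongrightarrow> f x"
  obtains q where "degree q \<le> n" "\<And>x. 0 \<le> x \<Longrightarrow> f x = poly q x"
proof -
  obtain L :: "nat \<Rightarrow> real poly" where L: "\<And>i. i \<le> n \<Longrightarrow> degree (L i) \<le> n"
    "\<And>p. degree p \<le> n \<Longrightarrow> p = (\<Sum>i\<le>n. smult (poly p (real i)) (L i))"
    using lagrange_interpolation by blast
  define q where "q = (\<Sum>i\<le>n. smult (f (real i)) (L i))"
  have "f x = poly q x" if "0 \<le> x" for x
  proof (rule LIMSEQ_unique)
    show "(\<lambda>k. poly (p k) x) \<longlonglongrightarrow> f x" using lim that by blast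
    have "(\<lambda>k. \<Sum>i\<le>n. poly (p k) (real i) * poly (L i) x) \<longlonglongrightarrow> (\<Sum>i\<le>n. f (real i) * poly (L i) x)"
      by (intro tendsto_sum tendsto_mult lim tendsto_const) simp
    moreover have "poly (p k) x = (\<Sum>i\<le>n. poly (p k) (real i) * poly (L i) x)" for k
      using arg_cong[OF L(2)[OF deg[of k]], of "\<lambda>p. poly p x"] by (simp add: poly_sum)
    ultimately show "(\<lambda>k. poly (p k) x) \<longlonglongrightarrow> poly q x"
      by (simp add: q_def poly_sum)
  qed
  moreover have "degree q \<le> n"
    unfolding q_def by (intro degree_sum_le) (auto intro: order.trans[OF degree_smult_le] L(1))
  ultimately show ?thesis using that by blast
qed

section \<open>Dilations, and the passage from zonotopes to the ball\<close>

lemma measure_scaleR_image: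
  fixes S :: "'a::euclidean_space set"
  shows "measure lebesgue ((*\<^sub>R) c ` S) = \<bar>c\<bar> ^ DIM('a) * measure lebesgue S"
  using measure_lebesgue_affine[of c 0 S] by simp

lemma scaleR_cball_0:
  "0 \<le> c \<Longrightarrow> 0 \<le> r \<Longrightarrow> (*\<^sub>R) c ` cball (0::'a::euclidean_space) r = cball 0 (c * r)"
  by (cases "c = 0") (auto simp: cball_scale image_constant_conv)

lemma scaleR_subset_convex:
  assumes "convex K" "0 \<in> K" "0 \<le> c" "c \<le> 1"
  shows "(*\<^sub>R) c ` K \<subseteq> K"
proof
  fix x assume "x \<in> (*\<^sub>R) c ` K"
  then obtain y where "y \<in> K" "x = c *\<^sub>R y" by auto
  then show "x \<in> K"
    using assms convexD_alt[of K 0 y c] by simp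
qed

lemma subset_scaleR_convex:
  assumes "convex K" "0 \<in> K" "1 \<le> c"
  shows "K \<subseteq> (*\<^sub>R) c ` K"
proof
  fix x assume "x \<in> K"
  then have "(1 / c) *\<^sub>R x \<in> K"
    using scaleR_subset_convex[of K "1 / c"] assms by auto
  then show "x \<in> (*\<^sub>R) c ` K"
    using assms by (intro image_eqI[of _ _ "(1 / c) *\<^sub>R x"]) auto
qed

text \<open>If the zonotope Z lies between the balls of radii 1 - d and 1 + d, then K + e Z lies
  between (1 - d)(K + e B) and (1 + d)(K + e B), because \<open>K\<close> contains the origin. So
  the zonotope polynomials converge to the volume of K + e B.\<close>

theorem steiner_polynomial:
  fixes K :: "'a::euclidean_space set"
  assumes K: "convex_body K" "0 \<in> K"
  obtains q where "degree q \<le> DIM('a)"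
    "\<And>e. 0 \<le> e \<Longrightarrow> measure lebesgue (K + cball 0 e) = poly q e"
proof -
  define d where "d k = 1 / real (k + 1)" for k
  have d: "0 < d k" "d k \<le> 1" for k by (auto simp: d_def)
  have "\<exists>vs::'a list. cball 0 (1 - d k) \<subseteq> zonotope vs \<and> zonotope vs \<subseteq> cball 0 (1 + d k)" for k
    using zonotope_approximates_cball[OF d(1)] by metis
  then obtain vs :: "nat \<Rightarrow> 'a list" where
    vs: "\<And>k. cball 0 (1 - d k) \<subseteq> zonotope (vs k)" "\<And>k. zonotope (vs k) \<subseteq> cball 0 (1 + d k)"
    by metis
  obtain p where p: "\<And>k e. 0 \<le> e \<Longrightarrow> measure lebesgue (K + (*\<^sub>R) e ` zonotope (vs k)) = poly (p k) e"
    using choice[of "\<lambda>k p. \<forall>e\<ge>0. measure lebesgue (K + (*\<^sub>R) e ` zonotope (vs k)) = poly p e"]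
      measure_plus_zonotope_poly[OF K(1)] by blast
  obtain R where R: "0 < R" "K \<subseteq> cball 0 R"
    using K(1) by (rule convex_body_subset_cball)
  have bodies: "convex_body (K + (*\<^sub>R) e ` zonotope (vs k))" "0 \<le> e \<Longrightarrow> convex_body (K + cball 0 e)" for e k
    using K by (auto intro!: convex_body_plus convex_body_scaleR)
  have deg: "degree (p k) \<le> DIM('a)" for k
  proof (rule degree_le_of_growth)
    fix x :: real assume x: "1 \<le> x"
    \<comment> \<open>\<open>K\<close> lies in the ball of radius R <= x R, and the zonotope in the
      ball of radius 1 + d k <= 2; the volume thus grows at most like x^n.\<close>
    have "K + (*\<^sub>R) x ` zonotope (vs k) \<subseteq> cball 0 (x * (R + 2))"
    proof
      fix z assume "z \<in> K + (*\<^sub>R) x ` zonotope (vs k)"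
      then obtain y v where z: "y \<in> K" "v \<in> zonotope (vs k)" "z = y + x *\<^sub>R v"
        by (auto simp: set_plus_def)
      have "norm z \<le> norm y + x * norm v"
        using z(3) x norm_triangle_ineq[of y "x *\<^sub>R v"] by simp
      moreover have "norm y \<le> x * R"
      proof -
        have "norm y \<le> 1 * R" using z(1) R by auto
        also have "\<dots> \<le> x * R" using R x by (intro mult_right_mono) auto
        finally show ?thesis .
      qed
      moreover have "x * norm v \<le> x * 2"
        using z(2) vs(2)[of k] d(2)[of k] x by (intro mult_left_mono) force+
      ultimately have "norm z \<le> x * (R + 2)"
        by (simp add: distrib_left)
      then show "z \<in> cball 0 (x * (R + 2))"
        by simp
    qed
    then have "measure lebesgue (K + (*\<^sub>R) x ` zonotope (vs k)) \<le> measure lebesgue (cball (0::'a) (x * (R + 2)))"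
      using bodies R x by (intro measure_mono_convex_body) auto
    also have "\<dots> = unit_ball_vol DIM('a) * (R + 2) ^ DIM('a) * x ^ DIM('a)"
      using R x by (simp add: content_cball power_mult_distrib)
    finally show "\<bar>poly (p k) x\<bar> \<le> unit_ball_vol DIM('a) * (R + 2) ^ DIM('a) * x ^ DIM('a)"
      using p[of x k] x measure_nonneg[of lebesgue "K + (*\<^sub>R) x ` zonotope (vs k)"] by simp
  qed
  have lim: "(\<lambda>k. poly (p k) e) \<longlonglongrightarrow> measure lebesgue (K + cball 0 e)" if e: "0 \<le> e" for e
  proof (rule tendsto_sandwich)
    let ?V = "measure lebesgue (K + cball 0 e)"
    have scale: "(*\<^sub>R) c ` (K + cball 0 e) = (*\<^sub>R) c ` K + (*\<^sub>R) e ` cball 0 c" if "0 \<le> c" for c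
      using that e by (simp add: scaleR_set_plus scaleR_cball_0 mult.commute)
    have "(1 - d k) ^ DIM('a) * ?V \<le> poly (p k) e" for k
    proof -
      have "(*\<^sub>R) (1 - d k) ` (K + cball 0 e) \<subseteq> K + (*\<^sub>R) e ` zonotope (vs k)"
      proof (subst scale)
        show "(*\<^sub>R) (1 - d k) ` K + (*\<^sub>R) e ` cball 0 (1 - d k) \<subseteq> K + (*\<^sub>R) e ` zonotope (vs k)"
          using K d[of k]
          by (intro set_plus_mono2 image_mono vs(1) scaleR_subset_convex) (auto simp: convex_body_def)
      qed (use d[of k] in simp)
      then have "measure lebesgue ((*\<^sub>R) (1 - d k) ` (K + cball 0 e)) \<le> measure lebesgue (K + (*\<^sub>R) e ` zonotope (vs k))"
        using bodies e by (intro measure_mono_convex_body convex_body_scaleR)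
      then show ?thesis
        using p[OF e, of k] d[of k] by (simp add: measure_scaleR_image)
    qed
    then show "\<forall>\<^sub>F k in sequentially. (1 - d k) ^ DIM('a) * ?V \<le> poly (p k) e"
      by simp
    have "poly (p k) e \<le> (1 + d k) ^ DIM('a) * ?V" for k
    proof -
      have "K + (*\<^sub>R) e ` zonotope (vs k) \<subseteq> (*\<^sub>R) (1 + d k) ` (K + cball 0 e)"
      proof (subst scale)
        show "K + (*\<^sub>R) e ` zonotope (vs k) \<subseteq> (*\<^sub>R) (1 + d k) ` K + (*\<^sub>R) e ` cball 0 (1 + d k)"
          using K d[of k]
          by (intro set_plus_mono2 image_mono vs(2) subset_scaleR_convex) (auto simp: convex_body_def)
      qed (use d[of k] in simp)
      then have "measure lebesgue (K + (*\<^sub>R) e ` zonotope (vs k)) \<le> measure lebesgue ((*\<^sub>R) (1 + d k) ` (K + cball 0 e))"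
        using bodies e by (intro measure_mono_convex_body convex_body_scaleR)
      then show ?thesis
        using p[OF e, of k] d[of k] by (simp add: measure_scaleR_image)
    qed
    then show "\<forall>\<^sub>F k in sequentially. poly (p k) e \<le> (1 + d k) ^ DIM('a) * ?V"
      by simp
    have d0: "d \<longlonglongrightarrow> 0"
      unfolding d_def using LIMSEQ_inverse_real_of_nat by (simp add: inverse_eq_divide add.commute)
    have "(\<lambda>k. (1 - d k) ^ DIM('a) * ?V) \<longlonglongrightarrow> (1 - 0) ^ DIM('a) * ?V"
      by (intro tendsto_intros d0)
    then show "(\<lambda>k. (1 - d k) ^ DIM('a) * ?V) \<longlonglongrightarrow> ?V" by simp
    have "(\<lambda>k. (1 + d k) ^ DIM('a) * ?V) \<longlonglongrightarrow> (1 + 0) ^ DIM('a) * ?V"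
      by (intro tendsto_intros d0)
    then show "(\<lambda>k. (1 + d k) ^ DIM('a) * ?V) \<longlonglongrightarrow> ?V" by simp
  qed
  from pointwise_limit_poly[OF deg lim] that show ?thesis by blast
qed

section \<open>Volumes of star bodies\<close>

lemma set_integrable_bounded_ball:
  fixes f :: "'a::euclidean_space \<Rightarrow> real"
  assumes [measurable]: "f \<in> borel_measurable borel" and "\<And>x. \<bar>f x\<bar> \<le> b"
  shows "set_integrable lborel (cball a r) f"
  unfolding set_integrable_def
proof (rule integrableI_bounded_set[where A = "cball a r" and B = b])
  show "AE x in lborel. x \<in> cball a r \<longrightarrow> norm (indicat_real (cball a r) x *\<^sub>R f x) \<le> b"
    using assms(2) by auto
  show "(\<lambda>x. indicat_real (cball a r) x *\<^sub>R f x) \<in> borel_measurable lborel"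
    using assms(1) by (intro borel_measurable_scaleR borel_measurable_indicator) auto
  show "emeasure lborel (cball a r) < \<infinity>"
    by (intro emeasure_bounded_finite bounded_cball)
qed auto

lemma set_integral_const_ball:
  "(LINT x:cball (0::'a) 1|lborel. c) = c * measure lborel (cball (0::'a::euclidean_space) 1)" for c :: real
  using emeasure_bounded_finite[of "cball (0::'a) 1"]
  by (simp add: set_lebesgue_integral_def mult.commute)

text \<open>Polar coordinates for a radial function \<open>f\<close> with finitely many values:
  \<open>f\<close> is constant on open rays from the origin, so the star body splits into sectors,
  and the sector with value \<open>c\<close> is the \<open>c\<close>-fold dilate of the
  corresponding sector of the unit ball.\<close>

lemma measure_star_body_finite_range:
  fixes f :: "'a::euclidean_space \<Rightarrow> real"
  assumes [measurable]: "f \<in> borel_measurable borel"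
    and hom: "\<And>c x. 0 < c \<Longrightarrow> f (c *\<^sub>R x) = f x" and nonneg: "\<And>x. 0 \<le> f x"
    and fin: "finite (range f)"
  shows "measure lborel {x. norm x \<le> f x} = (LINT x:cball 0 1|lborel. f x ^ DIM('a))"
proof -
  define C where "C c = {x \<in> cball 0 1. f x = c}" for c
  define D where "D c = {x. f x = c \<and> norm x \<le> c}" for c
  have [measurable]: "C c \<in> sets borel" "D c \<in> sets borel" for c
    by (simp_all add: C_def D_def)
  have finC: "emeasure lborel (C c) < \<infinity>" and finD: "emeasure lborel (D c) < \<infinity>" for c
  proof -
    have "C c \<subseteq> cball 0 1" "D c \<subseteq> cball 0 c"
      by (auto simp: C_def D_def)
    then show "emeasure lborel (C c) < \<infinity>" "emeasure lborel (D c) < \<infinity>"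
      by (meson bounded_cball bounded_subset emeasure_bounded_finite)+
  qed
  have scale: "measure lborel (D c) = c ^ DIM('a) * measure lborel (C c)" if "0 \<le> c" for c
  proof (cases "c = 0")
    \<comment> \<open>For c = 0 the sector is at most a point, and the right side vanishes because
      the dimension is positive.\<close>
    case True
    then have "D c \<subseteq> {0}" by (auto simp: D_def)
    then have "measure lborel (D c) = 0"
      by (metis emeasure_lborel_countable countable_subset countable_finite finite.emptyI
          finite_insert measure_eq_emeasure_eq_ennreal ennreal_0 order_refl)
    with True show ?thesis by simp
  next
    case False
    with that have c: "0 < c" by simp
    have DC: "D c = (*\<^sub>R) c ` C c"
    proof (intro set_eqI iffI)
      fix x assume "x \<in> D c"
      then have "(1 / c) *\<^sub>R x \<in> C c"
        using c hom[of "1 / c" x] by (simp add: D_def C_def)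
      then show "x \<in> (*\<^sub>R) c ` C c"
        using c by (intro image_eqI[of _ _ "(1 / c) *\<^sub>R x"]) auto
    next
      fix x assume "x \<in> (*\<^sub>R) c ` C c"
      then show "x \<in> D c"
        using c hom[of c] by (auto simp: D_def C_def)
    qed
    have "measure lebesgue (D c) = c ^ DIM('a) * measure lebesgue (C c)"
      using c by (simp add: DC measure_scaleR_image)
    then show ?thesis
      by simp
  qed
  have "measure lborel {x. norm x \<le> f x} = measure lborel (\<Union>c\<in>range f. D c)"
    by (intro arg_cong[where f = "measure lborel"]) (auto simp: D_def)
  also have "\<dots> = (\<Sum>c\<in>range f. measure lborel (D c))"
  proof (rule measure_finite_Union)
    show "disjoint_family_on D (range f)"
      by (auto simp: disjoint_family_on_def D_def)
    show "emeasure lborel (D c) \<noteq> \<infinity>" for c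
      using finD[of c] by simp
  qed (use fin in auto)
  also have "\<dots> = (\<Sum>c\<in>range f. c ^ DIM('a) * measure lborel (C c))"
    using nonneg by (intro sum.cong refl scale) auto
  also have "\<dots> = (\<Sum>c\<in>range f. (LINT x|lborel. c ^ DIM('a) * indicator (C c) x))"
    using finC by (intro sum.cong refl) simp
  also have "\<dots> = (LINT x|lborel. (\<Sum>c\<in>range f. c ^ DIM('a) * indicator (C c) x))"
    using finC by (intro Bochner_Integration.integral_sum[symmetric]) simp
  also have "\<dots> = (LINT x:cball 0 1|lborel. f x ^ DIM('a))"
    unfolding set_lebesgue_integral_def
  proof (rule Bochner_Integration.integral_cong[OF refl])
    fix x
    have "(\<Sum>c\<in>range f. c ^ DIM('a) * indicator (C c) x) =
        (\<Sum>c\<in>range f. if f x = c then c ^ DIM('a) * indicator (cball 0 1) x else 0)"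
      by (intro sum.cong refl) (auto simp: C_def indicator_def)
    also have "\<dots> = indicat_real (cball 0 1) x *\<^sub>R f x ^ DIM('a)"
      using fin by simp
    finally show "(\<Sum>c\<in>range f. c ^ DIM('a) * indicator (C c) x) = indicat_real (cball 0 1) x *\<^sub>R f x ^ DIM('a)" .
  qed
  finally show ?thesis .
qed

lemma power_diff_le:
  fixes x y :: real
  assumes "0 \<le> y" "y \<le> x"
  shows "x ^ Suc n - y ^ Suc n \<le> real (Suc n) * x ^ n * (x - y)"
proof (induction n)
  case (Suc n)
  have "x ^ Suc (Suc n) - y ^ Suc (Suc n) = x * (x ^ Suc n - y ^ Suc n) + (x - y) * y ^ Suc n"
    by (simp add: algebra_simps)
  also have "\<dots> \<le> x * (real (Suc n) * x ^ n * (x - y)) + (x - y) * x ^ Suc n"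
    using assms Suc by (intro add_mono mult_left_mono power_mono) auto
  finally show ?case by (simp add: algebra_simps)
qed simp

text \<open>Rounding \<open>f\<close> down to multiples of \<open>e\<close> gives a finite-range
  \<open>q\<close> with q <= f <= q + e. Both the volume of the star body and the integral are
  squeezed between their values for \<open>q\<close> and \<open>q + e\<close>, which differ by
  O(e).\<close>

lemma measure_star_body:
  fixes f :: "'a::euclidean_space \<Rightarrow> real"
  assumes [measurable]: "f \<in> borel_measurable borel"
    and hom: "\<And>c x. 0 < c \<Longrightarrow> f (c *\<^sub>R x) = f x"
    and nonneg: "\<And>x. 0 \<le> f x" and bound: "\<And>x. f x \<le> b"
  shows "measure lborel {x. norm x \<le> f x} = (LINT x:cball 0 1|lborel. f x ^ DIM('a))"
proof -
  let ?n = "DIM('a)"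
  let ?S = "\<lambda>g::'a \<Rightarrow> real. measure lborel {x. norm x \<le> g x}"
  let ?I = "\<lambda>g::'a \<Rightarrow> real. LINT x:cball 0 1|lborel. g x ^ ?n"
  define M where "M = measure lborel (cball (0::'a) 1)"
  have "0 \<le> b" using nonneg[of 0] bound[of 0] by simp
  obtain m where m: "?n = Suc m" using DIM_positive gr0_implies_Suc by blast
  \<comment> \<open>The derivative n r^(n-1) at r = b + 1, which bounds q + e, times the volume of
    the unit ball.\<close>
  define C where "C = real ?n * (b + 1) ^ m * M"
  have est: "\<bar>?S f - ?I f\<bar> \<le> C * inverse (real (Suc N))" for N
  proof -
    define e where "e = inverse (real (Suc N))"
    have e: "0 < e" "e \<le> 1" by (auto simp: e_def divide_simps)
    define q where "q x = real (nat \<lfloor>f x / e\<rfloor>) * e" for x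
    have [measurable]: "q \<in> borel_measurable borel" unfolding q_def by measurable
    have q: "0 \<le> q x" "q x \<le> f x" "f x \<le> q x + e" for x
    proof -
      have "real (nat \<lfloor>f x / e\<rfloor>) = real_of_int \<lfloor>f x / e\<rfloor>"
        using nonneg[of x] e by simp
      then have "real (nat \<lfloor>f x / e\<rfloor>) \<le> f x / e" "f x / e \<le> real (nat \<lfloor>f x / e\<rfloor>) + 1"
        by linarith+
      then show "0 \<le> q x" "q x \<le> f x" "f x \<le> q x + e"
        using e by (auto simp: q_def field_simps)
    qed
    have "range q \<subseteq> (\<lambda>k. real k * e) ` {..nat \<lfloor>b / e\<rfloor>}"
      using bound e by (auto simp: q_def intro!: imageI nat_mono floor_mono divide_right_mono)
    then have fin: "finite (range q)" by (rule finite_subset) simp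
    have homq: "q (c *\<^sub>R x) = q x" if "0 < c" for c x
      using hom[OF that] by (simp add: q_def)
    have "range (\<lambda>x. q x + e) = (\<lambda>y. y + e) ` range q" by auto
    with fin have fin': "finite (range (\<lambda>x. q x + e))" by simp
    have Sq: "?S q = ?I q"
      by (rule measure_star_body_finite_range) (use fin homq q in auto)
    have Sqe: "?S (\<lambda>x. q x + e) = ?I (\<lambda>x. q x + e)"
      by (rule measure_star_body_finite_range) (use fin' homq q e in \<open>auto intro: add_nonneg_nonneg\<close>)
    have fmeas: "{x. norm x \<le> g x} \<in> fmeasurable lborel"
      if [measurable]: "g \<in> borel_measurable borel" and "\<And>x. g x \<le> b + 1" for g :: "'a \<Rightarrow> real"
    proof (rule fmeasurableI)
      have "bounded {x. norm x \<le> g x}"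
      proof (rule bounded_subset[OF bounded_cball])
        show "{x. norm x \<le> g x} \<subseteq> cball 0 (b + 1)"
          using order_trans[OF _ that(2)] by auto
      qed
      then show "emeasure lborel {x. norm x \<le> g x} < \<infinity>"
        by (rule emeasure_bounded_finite)
    qed measurable
    have int: "set_integrable lborel (cball 0 1) (\<lambda>x. g x ^ ?n)"
      if [measurable]: "g \<in> borel_measurable borel" and "\<And>x. 0 \<le> g x" "\<And>x. g x \<le> b + 1" for g :: "'a \<Rightarrow> real"
      using that(2,3)
      by (intro set_integrable_bounded_ball[where b = "(b + 1) ^ ?n"]) (auto simp: power_mono)
    have up: "q x + e \<le> b + 1" "q x \<le> b + 1" "f x \<le> b + 1" for x
      using q[of x] bound[of x] e by auto
    have "?S q \<le> ?S f" "?S f \<le> ?S (\<lambda>x. q x + e)"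
      using q up by (auto intro!: measure_mono_fmeasurable fmeas fmeasurableD intro: order_trans)
    moreover have "?I q \<le> ?I f" "?I f \<le> ?I (\<lambda>x. q x + e)"
      using q nonneg up e
      by (auto intro!: set_integral_mono int power_mono add_nonneg_nonneg)
    moreover have "?I (\<lambda>x. q x + e) - ?I q \<le> C * e"
    proof -
      have "?I (\<lambda>x. q x + e) - ?I q = (LINT x:cball 0 1|lborel. (q x + e) ^ ?n - q x ^ ?n)"
        using q up e by (intro set_integral_diff(2)[symmetric] int) (auto intro: add_nonneg_nonneg)
      also have "\<dots> \<le> (LINT x:cball (0::'a) 1|lborel. real ?n * (b + 1) ^ m * e)"
      proof (rule set_integral_mono)
        show "set_integrable lborel (cball 0 1) (\<lambda>x. (q x + e) ^ ?n - q x ^ ?n)"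
          using q up e by (intro set_integral_diff(1) int) (auto intro: add_nonneg_nonneg)
        show "set_integrable lborel (cball (0::'a) 1) (\<lambda>x. real ?n * (b + 1) ^ m * e)"
          by (rule set_integrable_bounded_ball) auto
        fix x
        have "(q x + e) ^ ?n - q x ^ ?n \<le> real ?n * (q x + e) ^ m * e"
          using power_diff_le[of "q x" "q x + e" m] q[of x] e by (simp add: m)
        also have "\<dots> \<le> real ?n * (b + 1) ^ m * e"
          using q[of x] up[of x] e by (intro mult_right_mono mult_left_mono power_mono) auto
        finally show "(q x + e) ^ ?n - q x ^ ?n \<le> real ?n * (b + 1) ^ m * e" .
      qed
      also have "\<dots> = C * e" by (simp add: set_integral_const_ball C_def M_def ac_simps)
      finally show ?thesis .
    qed
    ultimately show ?thesis using Sq Sqe unfolding e_def by linarith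
  qed
  have "(\<lambda>N. C * inverse (real (Suc N))) \<longlonglongrightarrow> C * 0"
    by (intro tendsto_mult tendsto_const LIMSEQ_inverse_real_of_nat)
  then have "\<bar>?S f - ?I f\<bar> \<le> C * 0"
    by (rule tendsto_lowerbound) (use est in auto)
  then show ?thesis by simp
qed

section \<open>First-order expansion of the volume of the ball plus a small body\<close>

text \<open>The upper half of a first-order expansion with quadratic remainder; Bernoulli's
  inequality will supply the lower half. In the induction the cubic term is absorbed by z^3 <=
  z^2.\<close>

lemma one_plus_power_le_quadratic:
  "\<exists>C. \<forall>z. 0 \<le> z \<and> z \<le> 1 \<longrightarrow> (1 + z) ^ n \<le> 1 + real n * z + C * z\<^sup>2"
proof (induction n)
  case 0
  show ?case by (intro exI[of _ 0]) simp
next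
  case (Suc n)
  then obtain C where C: "\<And>z. 0 \<le> z \<Longrightarrow> z \<le> 1 \<Longrightarrow> (1 + z) ^ n \<le> 1 + real n * z + C * z\<^sup>2"
    by blast
  have "(1 + z) ^ Suc n \<le> 1 + real (Suc n) * z + (real n + 2 * \<bar>C\<bar>) * z\<^sup>2"
    if z: "0 \<le> z" "z \<le> 1" for z :: real
  proof -
    have "(1 + z) ^ n \<le> 1 + real n * z + \<bar>C\<bar> * z\<^sup>2"
      using C[OF z] mult_right_mono[of C "\<bar>C\<bar>" "z\<^sup>2", OF abs_ge_self zero_le_power2] by linarith
    then have "(1 + z) * (1 + z) ^ n \<le> (1 + z) * (1 + real n * z + \<bar>C\<bar> * z\<^sup>2)"
      using z by (intro mult_left_mono) auto
    also have "\<dots> = 1 + real (Suc n) * z + (real n + \<bar>C\<bar>) * z\<^sup>2 + \<bar>C\<bar> * z\<^sup>2 * z"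
      by (simp add: algebra_simps power2_eq_square)
    also have "\<dots> \<le> 1 + real (Suc n) * z + (real n + \<bar>C\<bar>) * z\<^sup>2 + \<bar>C\<bar> * z\<^sup>2 * 1"
      using z by (intro add_left_mono mult_left_mono) auto
    finally show ?thesis by (simp add: algebra_simps)
  qed
  then show ?case by blast
qed

lemma poly_coeff_0_eq_0:
  fixes p :: "real poly"
  assumes "0 < d" "\<And>x. 0 < x \<Longrightarrow> x < d \<Longrightarrow> \<bar>poly p x\<bar> \<le> C * x"
  shows "coeff p 0 = 0"
proof -
  have "((\<lambda>x. \<bar>poly p x\<bar>) \<longlongrightarrow> \<bar>poly p 0\<bar>) (at_right 0)"
    by (intro tendsto_intros)
  moreover have "((\<lambda>x. C * x) \<longlongrightarrow> C * 0) (at_right 0)"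
    by (intro tendsto_intros)
  moreover have "\<forall>\<^sub>F x in at_right 0. \<bar>poly p x\<bar> \<le> C * x"
    using assms by (auto simp: eventually_at_right_field)
  ultimately have "\<bar>poly p 0\<bar> \<le> C * 0"
    by (intro tendsto_le[of "at_right (0::real)"]) auto
  then show ?thesis by (simp add: poly_0_coeff_0)
qed

text \<open>The difference from a + b x is O(x^2): its constant term vanishes, and after division by
  x so does the next coefficient.\<close>

lemma poly_coeff_1_eq:
  fixes p :: "real poly"
  assumes "0 < d" and bound: "\<And>x. 0 < x \<Longrightarrow> x < d \<Longrightarrow> \<bar>poly p x - (a + b * x)\<bar> \<le> C * x\<^sup>2"
  shows "coeff p 1 = b"
proof -
  define r where "r = p - [:a, b:]"
  obtain c s where rs: "r = pCons c s" by (cases r)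
  have "coeff r 0 = 0"
  proof (rule poly_coeff_0_eq_0)
    show "0 < min 1 d" using assms by simp
    fix x assume x: "0 < x" "x < min 1 d"
    have "\<bar>poly r x\<bar> \<le> C * x\<^sup>2" using bound[of x] x by (simp add: r_def algebra_simps)
    also have "\<dots> \<le> \<bar>C\<bar> * x\<^sup>2" by (intro mult_right_mono) auto
    also have "\<dots> \<le> \<bar>C\<bar> * x" using x by (intro mult_left_mono) (auto simp: power2_eq_square mult_left_le_one_le)
    finally show "\<bar>poly r x\<bar> \<le> \<bar>C\<bar> * x" .
  qed
  then have "c = 0" by (simp add: rs)
  have "coeff s 0 = 0"
  proof (rule poly_coeff_0_eq_0[OF \<open>0 < d\<close>])
    fix x assume x: "0 < x" "x < d"
    have "x * \<bar>poly s x\<bar> = \<bar>poly r x\<bar>" using x by (simp add: rs \<open>c = 0\<close> abs_mult)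
    also have "\<dots> \<le> x * (C * x)" using bound[OF x] by (simp add: r_def algebra_simps power2_eq_square)
    finally show "\<bar>poly s x\<bar> \<le> C * x" using x by simp
  qed
  then have "coeff r 1 = 0" by (simp add: rs)
  then show ?thesis by (simp add: r_def)
qed

text \<open>The mean width of \<open>K\<close>, up to a constant factor.\<close>
definition mean_support :: "'a::euclidean_space set \<Rightarrow> real" where
  "mean_support K = (LINT x:cball 0 1|lborel. support_fun K (sgn x))"

section \<open>The support function as a function of direction, and the ball plus a small
  body\<close>

lemma borel_measurable_support_fun_sgn:
  fixes K :: "'a::euclidean_space set"
  assumes "convex_body K"
  shows "(\<lambda>x. support_fun K (sgn x)) \<in> borel_measurable borel"
  using borel_measurable_continuous_onI[OF continuous_on_support_fun[OF assms]]
  by (rule measurable_compose[rotated]) (rule borel_measurable_sgn)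

lemma support_fun_sgn_bounds:
  assumes "convex_body K" "0 \<in> K" "K \<subseteq> cball 0 R"
  shows "0 \<le> support_fun K (sgn x)" "support_fun K (sgn x) \<le> R"
proof -
  show "0 \<le> support_fun K (sgn x)"
    using assms by (simp add: support_fun_nonneg)
  have "0 \<le> R" using assms by auto
  then show "support_fun K (sgn x) \<le> R"
    using support_fun_bounded[OF assms(1,3), of "sgn x"] by (auto simp: norm_sgn split: if_splits)
qed

lemma integrable_support_fun_sgn:
  fixes K :: "'a::euclidean_space set"
  assumes K: "convex_body K" "0 \<in> K"
  shows "set_integrable lborel (cball 0 1) (\<lambda>x. support_fun K (sgn x))"
proof -
  obtain R where "0 < R" "K \<subseteq> cball 0 R"
    using K(1) by (rule convex_body_subset_cball)
  then show ?thesis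
    using support_fun_sgn_bounds[OF K, of R] borel_measurable_support_fun_sgn[OF K(1)]
    by (intro set_integrable_bounded_ball[where b = R]) auto
qed

text \<open>The norm of a point is its inner product with its own direction, hence at most the
  support function of the body there, and that of B + d K is 1 + d h_K.\<close>

lemma ball_plus_subset_star:
  assumes K: "convex_body K" "0 \<in> K" and "0 \<le> d"
  shows "cball 0 1 + (*\<^sub>R) d ` K \<subseteq> {x. norm x \<le> 1 + d * support_fun K (sgn x)}"
proof
  fix x assume "x \<in> cball 0 1 + (*\<^sub>R) d ` K"
  then obtain b y where x: "norm b \<le> 1" "y \<in> K" "x = b + d *\<^sub>R y"
    by (auto simp: set_plus_def)
  have "norm x = sgn x \<bullet> x"
    by (cases "x = 0") (auto simp: sgn_div_norm dot_square_norm power2_eq_square)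
  also have "\<dots> = sgn x \<bullet> b + d * (sgn x \<bullet> y)"
    by (subst (2) x(3)) (simp add: inner_add_right)
  also have "sgn x \<bullet> b \<le> norm (sgn x) * norm b"
    by (rule norm_cauchy_schwarz)
  also have "\<dots> \<le> 1"
    using x(1) by (simp add: norm_sgn)
  also have "d * (sgn x \<bullet> y) \<le> d * support_fun K (sgn x)"
    using assms x by (intro mult_left_mono inner_le_support_fun)
  finally show "x \<in> {x. norm x \<le> 1 + d * support_fun K (sgn x)}" by simp
qed

text \<open>Subtract \<open>d y\<close> from \<open>x\<close>, where \<open>y\<close> is a point of
  \<open>K\<close> farthest in the direction of \<open>x\<close>. The component along
  \<open>x\<close> becomes at most 1 - (d R)^2 in absolute value, and the orthogonal one at most d
  R; the margin (d R)^2 pays for the square of the latter.\<close>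

lemma star_subset_ball_plus:
  assumes K: "convex_body K" "0 \<in> K" "K \<subseteq> cball 0 R" and d: "0 \<le> d" "d * R \<le> 1 / 2"
  shows "{x. norm x \<le> 1 + d * support_fun K (sgn x) - (d * R)\<^sup>2} \<subseteq> cball 0 1 + (*\<^sub>R) d ` K"
proof
  fix x assume "x \<in> {x. norm x \<le> 1 + d * support_fun K (sgn x) - (d * R)\<^sup>2}"
  then have x: "norm x \<le> 1 + d * support_fun K (sgn x) - (d * R)\<^sup>2" by simp
  obtain y where y: "y \<in> K" "support_fun K (sgn x) = sgn x \<bullet> y"
    using support_fun_attained[OF K(1)] by metis
  define h where "h = support_fun K (sgn x)"
  have R: "0 \<le> R" "norm y \<le> R" using K y(1) by auto
  have h: "0 \<le> h" "h \<le> R" using support_fun_sgn_bounds[OF K] by (auto simp: h_def)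
  have dR: "0 \<le> d * R" "(d * R)\<^sup>2 \<le> 1 / 4"
    using d R power_mono[of "d * R" "1 / 2" 2] by (auto simp: power2_eq_square)
  have dh: "0 \<le> d * h" "d * h \<le> d * R" using d h by (auto intro: mult_left_mono)
  have "x \<bullet> y = norm x * h"
    unfolding h_def y(2) by (cases "x = 0") (auto simp: sgn_div_norm)
  then have "(norm (x - d *\<^sub>R y))\<^sup>2 = (norm x)\<^sup>2 - 2 * d * (norm x * h) + d\<^sup>2 * (norm y)\<^sup>2"
    unfolding power2_norm_eq_inner
    by (simp add: inner_diff_left inner_diff_right inner_commute[of y x] power2_eq_square[of d] right_diff_distrib)
  \<comment> \<open>Pythagoras for the parts of x - d y along and orthogonal to
    \<open>sgn x\<close>.\<close>
  also have "\<dots> = (norm x - d * h)\<^sup>2 + d\<^sup>2 * ((norm y)\<^sup>2 - h\<^sup>2)"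
    by (simp add: power2_eq_square algebra_simps)
  also have "\<dots> \<le> (1 - (d * R)\<^sup>2)\<^sup>2 + (d * R)\<^sup>2"
  proof (rule add_mono)
    have "\<bar>norm x - d * h\<bar> \<le> 1 - (d * R)\<^sup>2"
      using x dh dR d(2) norm_ge_zero[of x] unfolding h_def[symmetric] abs_le_iff by linarith
    then show "(norm x - d * h)\<^sup>2 \<le> (1 - (d * R)\<^sup>2)\<^sup>2"
      using power2_le_iff_abs_le[of "1 - (d * R)\<^sup>2"] dR by simp
    have "(norm y)\<^sup>2 - h\<^sup>2 \<le> R\<^sup>2"
      using power_mono[OF R(2) norm_ge_zero, of 2] zero_le_power2[of h] by linarith
    then have "d\<^sup>2 * ((norm y)\<^sup>2 - h\<^sup>2) \<le> d\<^sup>2 * R\<^sup>2"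
      by (intro mult_left_mono) auto
    then show "d\<^sup>2 * ((norm y)\<^sup>2 - h\<^sup>2) \<le> (d * R)\<^sup>2"
      by (simp add: power_mult_distrib)
  qed
  also have "\<dots> = 1 - (d * R)\<^sup>2 * (1 - (d * R)\<^sup>2)"
    by (simp add: power2_eq_square algebra_simps)
  also have "\<dots> \<le> 1"
    using dR by simp
  finally have "norm (x - d *\<^sub>R y) \<le> 1"
    by (simp add: power2_le_iff_abs_le abs_square_le_1)
  then show "x \<in> cball 0 1 + (*\<^sub>R) d ` K"
    using set_plus_intro[of "x - d *\<^sub>R y" "cball 0 1" "d *\<^sub>R y" "(*\<^sub>R) d ` K"] imageI[OF y(1), of "(*\<^sub>R) d"] by simp
qed

text \<open>B + d K lies between star bodies with radial functions 1 + d h - (d R)^2 and 1 + d h.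
  Their volumes are integrals of n-th powers, so both equal the ball's volume plus n d times the
  integral of h, up to O(d^2).\<close>

lemma measure_ball_plus_expansion:
  fixes K :: "'a::euclidean_space set"
  assumes K: "convex_body K" "0 \<in> K"
  obtains C e where "0 < e"
    "\<And>d. 0 < d \<Longrightarrow> d < e \<Longrightarrow>
      \<bar>measure lebesgue (cball 0 1 + (*\<^sub>R) d ` K) -
        (measure lborel (cball (0::'a) 1) + real DIM('a) * mean_support K * d)\<bar> \<le> C * d\<^sup>2"
proof -
  let ?n = "DIM('a)"
  obtain R where R: "0 < R" "K \<subseteq> cball 0 R"
    using K(1) by (rule convex_body_subset_cball)
  define h where "h x = support_fun K (sgn x)" for x
  have h: "0 \<le> h x" "h x \<le> R" for x
    using support_fun_sgn_bounds[OF K R(2)] by (auto simp: h_def)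
  have [measurable]: "h \<in> borel_measurable borel"
    unfolding h_def by (rule borel_measurable_support_fun_sgn[OF K(1)])
  have hom: "h (c *\<^sub>R x) = h x" if "0 < c" for c x
    using that by (simp add: h_def sgn_scaleR)
  define M where "M = measure lborel (cball (0::'a) 1)"
  define I where "I = mean_support K"
  obtain C where C: "\<And>z. 0 \<le> z \<Longrightarrow> z \<le> 1 \<Longrightarrow> (1 + z) ^ ?n \<le> 1 + real ?n * z + C * z\<^sup>2"
    using one_plus_power_le_quadratic by blast
  define W where "W d = measure lebesgue (cball 0 1 + (*\<^sub>R) d ` K)" for d
  \<comment> \<open>The larger of the second-order constants in the upper and the lower
    estimate.\<close>
  define A where "A = max (\<bar>C\<bar> * R\<^sup>2 * M) (real ?n * R\<^sup>2 * M)"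
  have "\<bar>W d - (M + real ?n * I * d)\<bar> \<le> A * d\<^sup>2" if d: "0 < d" "d < 1 / (2 * R)" for d
  proof -
    have dR: "0 < d * R" "d * R < 1 / 2" "(d * R)\<^sup>2 \<le> 1 / 4"
      using d R power_mono[of "d * R" "1 / 2" 2] by (auto simp: field_simps power2_eq_square)
    have dh: "0 \<le> d * h x" "d * h x \<le> d * R" for x
      using d h by (auto intro: mult_left_mono)
    have body: "cball 0 1 + (*\<^sub>R) d ` K \<in> lmeasurable"
      using K by (intro lmeasurable_convex_body convex_body_plus convex_body_scaleR) auto
    have star: "measure lebesgue {x. norm x \<le> 1 + d * h x - s} = (LINT x:cball 0 1|lborel. (1 + d * h x - s) ^ ?n)"
      and star_meas: "{x. norm x \<le> 1 + d * h x - s} \<in> lmeasurable"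
      if s: "0 \<le> s" "s \<le> 1" for s
    proof -
      have [measurable]: "{x. norm x \<le> 1 + d * h x - s} \<in> sets borel" by measurable
      have "measure lborel {x. norm x \<le> 1 + d * h x - s} = (LINT x:cball 0 1|lborel. (1 + d * h x - s) ^ ?n)"
      proof (rule measure_star_body)
        show "1 + d * h x - s \<le> 1 + d * R" for x using dh[of x] s by linarith
        show "0 \<le> 1 + d * h x - s" for x using dh[of x] s by linarith
      qed (auto simp: hom)
      then show "measure lebesgue {x. norm x \<le> 1 + d * h x - s} = (LINT x:cball 0 1|lborel. (1 + d * h x - s) ^ ?n)"
        by simp
      have "{x. norm x \<le> 1 + d * h x - s} \<subseteq> cball 0 (1 + d * R)"
      proof
        fix x assume "x \<in> {x. norm x \<le> 1 + d * h x - s}"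
        then show "x \<in> cball 0 (1 + d * R)" using dh[of x] s by simp
      qed
      then have "bounded {x. norm x \<le> 1 + d * h x - s}" by (rule bounded_subset[OF bounded_cball])
      then show "{x. norm x \<le> 1 + d * h x - s} \<in> lmeasurable"
        by (intro bounded_set_imp_lmeasurable) auto
    qed
    have int_h: "set_integrable lborel (cball 0 1) h"
      unfolding h_def by (rule integrable_support_fun_sgn[OF K])
    have int_lin: "set_integrable lborel (cball 0 1) (\<lambda>x. a + b * h x)" for a b
      by (intro set_integral_add(1) set_integrable_mult_right int_h)
        (rule set_integrable_bounded_ball[of _ "\<bar>a\<bar>"], auto)
    have lin: "(LINT x:cball 0 1|lborel. a + b * h x) = a * M + b * I" for a b
    proof -
      have "(LINT x:cball 0 1|lborel. a + b * h x) = (LINT x:cball (0::'a) 1|lborel. a) + (LINT x:cball 0 1|lborel. b * h x)"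
        by (intro set_integral_add(2) set_integrable_mult_right int_h)
          (rule set_integrable_bounded_ball[of _ "\<bar>a\<bar>"], auto)
      then show ?thesis
        unfolding set_integral_const_ball I_def mean_support_def M_def h_def by simp
    qed
    have int_pow: "set_integrable lborel (cball 0 1) (\<lambda>x. (1 + d * h x - s) ^ ?n)"
      if s: "0 \<le> s" "s \<le> 1" for s
    proof (rule set_integrable_bounded_ball)
      fix x
      have "0 \<le> 1 + d * h x - s" "1 + d * h x - s \<le> 2" using dh[of x] dR s by linarith+
      then show "\<bar>(1 + d * h x - s) ^ ?n\<bar> \<le> 2 ^ ?n" by (simp add: power_mono)
    qed measurable
    have "W d \<le> measure lebesgue {x. norm x \<le> 1 + d * h x - 0}"
      unfolding W_def using ball_plus_subset_star[OF K, of d] d body star_meas[of 0]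
      by (intro measure_mono_fmeasurable) (auto simp: h_def fmeasurableD)
    also have "\<dots> = (LINT x:cball 0 1|lborel. (1 + d * h x - 0) ^ ?n)"
      by (rule star) auto
    also have "\<dots> \<le> (LINT x:cball 0 1|lborel. (1 + \<bar>C\<bar> * (d * R)\<^sup>2) + (real ?n * d) * h x)"
    proof (rule set_integral_mono[OF int_pow int_lin])
      fix x
      have "(1 + d * h x) ^ ?n \<le> 1 + real ?n * (d * h x) + C * (d * h x)\<^sup>2"
        using dh[of x] dR by (intro C) auto
      also have "C * (d * h x)\<^sup>2 \<le> \<bar>C\<bar> * (d * R)\<^sup>2"
        using power_mono[OF dh(2) dh(1), of x 2] by (intro mult_mono) (auto simp del: power_mult_distrib)
      finally show "(1 + d * h x - 0) ^ ?n \<le> (1 + \<bar>C\<bar> * (d * R)\<^sup>2) + (real ?n * d) * h x"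
        by simp
    qed auto
    also have "\<dots> = M + real ?n * I * d + \<bar>C\<bar> * R\<^sup>2 * M * d\<^sup>2"
      unfolding lin by (simp add: algebra_simps power_mult_distrib)
    also have "\<dots> \<le> M + real ?n * I * d + A * d\<^sup>2"
      by (intro add_left_mono mult_right_mono) (auto simp: A_def)
    finally have upper: "W d \<le> M + real ?n * I * d + A * d\<^sup>2" .
    have "M + real ?n * I * d - A * d\<^sup>2 \<le> M + real ?n * I * d - real ?n * R\<^sup>2 * M * d\<^sup>2"
      by (intro diff_left_mono mult_right_mono) (auto simp: A_def)
    also have "\<dots> = (LINT x:cball 0 1|lborel. (1 - real ?n * (d * R)\<^sup>2) + (real ?n * d) * h x)"
      unfolding lin by (simp add: algebra_simps power_mult_distrib)
    also have "\<dots> \<le> (LINT x:cball 0 1|lborel. (1 + d * h x - (d * R)\<^sup>2) ^ ?n)"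
    proof (rule set_integral_mono[OF int_lin int_pow])
      fix x
      have "1 + real ?n * (d * h x - (d * R)\<^sup>2) \<le> (1 + (d * h x - (d * R)\<^sup>2)) ^ ?n"
        using dh[of x] dR by (intro Bernoulli_inequality) linarith
      then show "(1 - real ?n * (d * R)\<^sup>2) + (real ?n * d) * h x \<le> (1 + d * h x - (d * R)\<^sup>2) ^ ?n"
        by (simp add: algebra_simps)
    qed (use dR in auto)
    also have "\<dots> = measure lebesgue {x. norm x \<le> 1 + d * h x - (d * R)\<^sup>2}"
      by (rule star[symmetric]) (use dR in auto)
    also have "\<dots> \<le> W d"
      unfolding W_def using star_subset_ball_plus[OF K R(2), of d] d dR body star_meas[of "(d * R)\<^sup>2"]
      by (intro measure_mono_fmeasurable) (auto simp: h_def fmeasurableD)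
    finally show ?thesis using upper by (simp add: abs_le_iff)
  qed
  then show ?thesis
    using that[of "1 / (2 * R)" A] R unfolding W_def M_def I_def by simp
qed

section \<open>The first intrinsic volume\<close>

lemma poly_eqI_nonneg:
  fixes p q :: "real poly"
  assumes "\<And>x. 0 \<le> x \<Longrightarrow> poly p x = poly q x"
  shows "p = q"
proof -
  have "infinite {x. poly (p - q) x = 0}"
  proof
    assume "finite {x. poly (p - q) x = 0}"
    then have "finite {0::real..}"
      by (rule finite_subset[rotated]) (use assms in auto)
    then show False by (simp add: infinite_Ici)
  qed
  then show ?thesis
    using poly_roots_finite[of "p - q"] by auto
qed

text \<open>The Steiner formula attaches \<open>V j\<close> to the power n - j, so coefficients are
  read off in reverse order.\<close>

lemma coeff_poly_reversed_sum:
  fixes a :: "nat \<Rightarrow> real"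
  assumes "j \<le> n"
  shows "coeff (\<Sum>i\<le>n. monom (a i) (n - i)) (n - j) = a j"
proof -
  have "coeff (\<Sum>i\<le>n. monom (a i) (n - i)) (n - j) = (\<Sum>i\<le>n. if i = j then a i else 0)"
    unfolding coeff_sum using assms by (intro sum.cong) auto
  then show ?thesis using assms by simp
qed

text \<open>This resolves the definite description: values on e >= 0 determine the coefficients, the
  unit ball volumes are nonzero, and the entries above the dimension are fixed to 0.\<close>

lemma intrinsic_volume_eq_coeff:
  fixes K :: "'a::euclidean_space set"
  assumes deg: "degree q \<le> DIM('a)"
    and q: "\<And>e. 0 \<le> e \<Longrightarrow> measure lebesgue (K + cball 0 e) = poly q e"
    and k: "k \<le> DIM('a)"
  shows "intrinsic_volume k K = coeff q (DIM('a) - k) / unit_ball_vol (real (DIM('a) - k))"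
proof -
  let ?n = "DIM('a)"
  let ?kap = "\<lambda>j. unit_ball_vol (real (?n - j))"
  let ?P = "\<lambda>V :: nat \<Rightarrow> real. (\<forall>j > ?n. V j = 0) \<and>
        (\<forall>e\<ge>0. measure lebesgue {x + e *\<^sub>R u | x u. x \<in> K \<and> u \<in> cball 0 1} =
           (\<Sum>j\<le>?n. e ^ (?n - j) * ?kap j * V j))"
  define V where "V j = (if j \<le> ?n then coeff q (?n - j) / ?kap j else 0)" for j
  have kap: "?kap j \<noteq> 0" for j
    using unit_ball_vol_pos[of "real (?n - j)", THEN less_imp_neq] by simp
  have set_eq: "{x + e *\<^sub>R u | x u. x \<in> K \<and> u \<in> cball 0 1} = K + cball 0 e" if "0 \<le> e" for e
  proof -
    have ball: "cball 0 e = (*\<^sub>R) e ` cball (0::'a) 1"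
      using that by (simp add: scaleR_cball_0)
    show ?thesis unfolding set_plus_def ball by blast
  qed
  \<comment> \<open>The Steiner formula becomes an identity of polynomials, so existence and
    uniqueness both reduce to comparing coefficients.\<close>
  have iff: "?P W \<longleftrightarrow> (\<forall>j > ?n. W j = 0) \<and> q = (\<Sum>j\<le>?n. monom (?kap j * W j) (?n - j))" for W
  proof -
    have "poly (\<Sum>j\<le>?n. monom (?kap j * W j) (?n - j)) e = (\<Sum>j\<le>?n. e ^ (?n - j) * ?kap j * W j)" for e
      by (simp add: poly_sum poly_monom ac_simps)
    then show ?thesis
      using q set_eq by (auto intro!: poly_eqI_nonneg)
  qed
  have "?P V"
    unfolding iff
  proof (intro conjI allI impI poly_eqI)
    fix i
    show "coeff q i = coeff (\<Sum>j\<le>?n. monom (?kap j * V j) (?n - j)) i"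
    proof (cases "i \<le> ?n")
      case True
      then show ?thesis
        using coeff_poly_reversed_sum[of "?n - i" ?n "\<lambda>j. ?kap j * V j"] kap[of "?n - i"]
        by (simp add: V_def)
    next
      case False
      then have "coeff (\<Sum>j\<le>?n. monom (?kap j * V j) (?n - j)) i = 0"
        unfolding coeff_sum by (intro sum.neutral) auto
      then show ?thesis
        using False deg by (simp add: coeff_eq_0)
    qed
  qed (simp add: V_def)
  moreover have "W = V" if "?P W" for W
  proof
    fix j
    show "W j = V j"
    proof (cases "j \<le> ?n")
      case True
      then have "coeff q (?n - j) = ?kap j * W j"
        using that coeff_poly_reversed_sum[of j ?n "\<lambda>j. ?kap j * W j"] unfolding iff by simp
      then show ?thesis using True kap[of j] by (simp add: V_def)
    qed (use that in \<open>simp add: V_def\<close>)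
  qed
  ultimately have "(THE V. ?P V) = V"
    by (rule the_equality)
  then show ?thesis
    using k by (simp add: intrinsic_volume_def V_def)
qed

text \<open>Since B + d K = d (K + B/d), its volume is the Steiner polynomial with coefficients
  reversed. Thus V_1, found at e^(n-1), becomes the linear coefficient, which the expansion near d =
  0 identifies.\<close>

theorem intrinsic_volume_1_eq_mean_support:
  fixes K :: "'a::euclidean_space set"
  assumes K: "convex_body K" "0 \<in> K"
  shows "intrinsic_volume 1 K =
    real DIM('a) / unit_ball_vol (real (DIM('a) - 1)) * mean_support K"
proof -
  let ?n = "DIM('a)"
  obtain q where q: "degree q \<le> ?n" "\<And>e. 0 \<le> e \<Longrightarrow> measure lebesgue (K + cball 0 e) = poly q e"
    using steiner_polynomial[OF K] by blast
  define r where "r = (\<Sum>j\<le>?n. monom (coeff q j) (?n - j))"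
  have W: "measure lebesgue (cball 0 1 + (*\<^sub>R) d ` K) = poly r d" if d: "0 < d" for d
  proof -
    have "cball 0 1 + (*\<^sub>R) d ` K = (*\<^sub>R) d ` (K + cball 0 (1 / d))"
      using d by (simp add: scaleR_set_plus scaleR_cball_0 add.commute)
    then have "measure lebesgue (cball 0 1 + (*\<^sub>R) d ` K) = d ^ ?n * poly q (1 / d)"
      using d q(2)[of "1 / d"] by (simp add: measure_scaleR_image)
    also have "poly q (1 / d) = (\<Sum>j\<le>?n. coeff q j * (1 / d) ^ j)"
      unfolding poly_altdef using q(1) by (intro sum.mono_neutral_left) (auto intro: coeff_eq_0)
    also have "d ^ ?n * \<dots> = (\<Sum>j\<le>?n. coeff q j * d ^ (?n - j))"
      unfolding sum_distrib_left
    proof (intro sum.cong refl)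
      fix j assume "j \<in> {..?n}"
      then have "d ^ ?n = d ^ (?n - j) * d ^ j" by (simp flip: power_add)
      then show "d ^ ?n * (coeff q j * (1 / d) ^ j) = coeff q j * d ^ (?n - j)"
        using d by (simp add: power_divide)
    qed
    finally show ?thesis by (simp add: r_def poly_sum poly_monom)
  qed
  obtain C e where "0 < e" and bound: "\<And>d. 0 < d \<Longrightarrow> d < e \<Longrightarrow>
      \<bar>measure lebesgue (cball 0 1 + (*\<^sub>R) d ` K) -
        (measure lborel (cball (0::'a) 1) + real ?n * mean_support K * d)\<bar> \<le> C * d\<^sup>2"
    using measure_ball_plus_expansion[OF K] by blast
  have "coeff r 1 = real ?n * mean_support K"
    by (rule poly_coeff_1_eq[OF \<open>0 < e\<close>]) (use bound W in simp)
  moreover have "coeff r (?n - (?n - 1)) = coeff q (?n - 1)"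
    unfolding r_def by (rule coeff_poly_reversed_sum) simp
  ultimately have "coeff q (?n - 1) = real ?n * mean_support K"
    by (simp add: Suc_leI)
  then show ?thesis
    using intrinsic_volume_eq_coeff[OF q, of 1] by (simp add: Suc_leI)
qed

section \<open>Additivity, homogeneity and strict monotonicity of V_1\<close>

lemma intrinsic_volume_1_plus:
  assumes "convex_body K" "0 \<in> K" "convex_body L" "0 \<in> L"
  shows "intrinsic_volume 1 (K + L) = intrinsic_volume 1 K + intrinsic_volume 1 L"
proof -
  have "mean_support (K + L) = mean_support K + mean_support L"
    unfolding mean_support_def support_fun_plus[OF assms(1,3)]
    using assms by (intro set_integral_add integrable_support_fun_sgn)
  then show ?thesis
    using assms by (simp add: intrinsic_volume_1_eq_mean_support convex_body_plus zero_in_plus distrib_left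
        del: One_nat_def)
qed

lemma intrinsic_volume_1_scaleR:
  assumes "convex_body K" "0 \<in> K" "0 \<le> c"
  shows "intrinsic_volume 1 ((*\<^sub>R) c ` K) = c * intrinsic_volume 1 K"
proof -
  have "0 \<in> (*\<^sub>R) c ` K"
    using assms by force
  moreover have "mean_support ((*\<^sub>R) c ` K) = c * mean_support K"
    using assms by (simp add: mean_support_def support_fun_scaleR_set)
  ultimately show ?thesis
    using assms by (simp add: intrinsic_volume_1_eq_mean_support convex_body_scaleR del: One_nat_def)
qed

lemma intrinsic_volume_1_strict_mono:
  fixes K L :: "'a::euclidean_space set"
  assumes K: "convex_body K" "0 \<in> K" and L: "convex_body L" and "K \<subset> L"
  shows "intrinsic_volume 1 K < intrinsic_volume 1 L"
proof -
  have L0: "0 \<in> L" using assms by auto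
  let ?f = "\<lambda>x. support_fun L (sgn x) - support_fun K (sgn x)"
  have nonneg: "0 \<le> ?f x" for x
    using support_fun_mono[OF K(1) L, of "sgn x"] \<open>K \<subset> L\<close> by auto
  obtain u where u: "norm u = 1" "support_fun K u < support_fun L u"
  proof -
    have "\<not> L \<subseteq> K" using \<open>K \<subset> L\<close> by auto
    then show ?thesis
      using that unfolding subset_iff_support_fun[OF L K(1)] by (force simp: not_le)
  qed
  have int: "set_integrable lborel (cball 0 1) ?f"
    by (intro set_integral_diff(1) integrable_support_fun_sgn K L L0)
  have "0 < (LINT x:cball 0 1|lborel. ?f x)"
  \<comment> \<open>The support functions differ at \<open>u\<close>, hence at every positive
    multiple of it; the open ball of radius 1/2 about u/2 avoids the origin, so \<open>sgn\<close>
    is continuous there.\<close>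
  proof (rule integral_pos_continuous[where a = "u /\<^sub>R 2" and r = "1 / 2"])
    have nonzero: "x \<noteq> 0" if "x \<in> ball (u /\<^sub>R 2) (1 / 2)" for x
      using that u(1) by (auto simp: dist_norm)
    have "continuous_on (ball (u /\<^sub>R 2) (1 / 2)) (\<lambda>x. x /\<^sub>R norm x)"
      using nonzero by (intro continuous_intros) auto
    then have sgn: "continuous_on (ball (u /\<^sub>R 2) (1 / 2)) sgn"
      by (simp add: sgn_div_norm[abs_def])
    have "continuous_on (ball (u /\<^sub>R 2) (1 / 2)) (\<lambda>x. support_fun M (sgn x))"
      if "convex_body M" for M :: "'a set"
      using continuous_on_compose2[OF continuous_on_support_fun[OF that, of UNIV] sgn] by simp
    then show "continuous_on (ball (u /\<^sub>R 2) (1 / 2)) ?f"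
      using K(1) L by (intro continuous_intros) auto
    show "ball (u /\<^sub>R 2) (1 / 2) \<subseteq> cball 0 1"
    proof
      fix x assume "x \<in> ball (u /\<^sub>R 2) (1/2)"
      then have "norm (x - u /\<^sub>R 2) < 1/2" by (simp add: dist_norm norm_minus_commute)
      moreover have "norm x \<le> norm (x - u /\<^sub>R 2) + norm (u /\<^sub>R 2)"
        using norm_triangle_ineq[of "x - u /\<^sub>R 2" "u /\<^sub>R 2"] by simp
      ultimately show "x \<in> cball 0 1" using u(1) by simp
    qed
    have "sgn (u /\<^sub>R 2) = u" using u(1) by (simp add: sgn_div_norm)
    then show "0 < ?f (u /\<^sub>R 2)" using u(2) by simp
  qed (use int nonneg in auto)
  also have "\<dots> = mean_support L - mean_support K"
    unfolding mean_support_def by (intro set_integral_diff(2) integrable_support_fun_sgn K L L0)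
  finally have "mean_support K < mean_support L" by simp
  moreover have "0 < real DIM('a) / unit_ball_vol (real (DIM('a) - 1))"
    by (intro divide_pos_pos unit_ball_vol_pos) auto
  ultimately show ?thesis
    unfolding intrinsic_volume_1_eq_mean_support[OF K] intrinsic_volume_1_eq_mean_support[OF L L0]
    by (rule mult_strict_left_mono)
qed

section \<open>Power means and the inequality\<close>

text \<open>Sum ln z <= z - 1 at z = x/m and z = y/m, where \<open>m\<close> is the arithmetic mean:
  the right sides cancel, and x/m differs from 1.\<close>

lemma weighted_am_gm_strict:
  fixes x y u v :: real
  assumes "0 < u" "0 < v" "u + v = 1" "0 \<le> x" "0 \<le> y" "x \<noteq> y"
  shows "x powr u * y powr v < u * x + v * y"
proof (cases "x = 0 \<or> y = 0")
  case True
  then show ?thesis using assms by auto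
next
  case False
  then have xy: "0 < x" "0 < y" using assms by auto
  define m where "m = u * x + v * y"
  have m: "0 < m" using assms xy by (simp add: m_def add_pos_pos)
  have le: "ln (z / m) \<le> z / m - 1" if "0 < z" for z
    using that m by (intro ln_le_minus_one) auto
  have less: "ln (z / m) < z / m - 1" if "0 < z" "z \<noteq> m" for z
    using le[OF that(1)] ln_eq_minus_one[of "z / m"] that m by force
  have "x \<noteq> m"
  proof
    assume "x = m"
    then have "(1 - u) * x = v * y" by (simp add: m_def algebra_simps)
    moreover have "1 - u = v" using assms by simp
    ultimately show False using assms by simp
  qed
  then have "u * ln (x / m) + v * ln (y / m) < u * (x / m - 1) + v * (y / m - 1)"
    using assms xy by (intro add_less_le_mono mult_strict_left_mono mult_left_mono less le) auto
  also have "\<dots> = (u * x + v * y) / m - (u + v)"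
    by (simp add: algebra_simps add_divide_distrib)
  also have "\<dots> = 0" using m assms by (simp add: m_def)
  finally have "u * ln x + v * ln y < (u + v) * ln m"
    using xy m by (simp add: ln_div algebra_simps)
  then have "exp (u * ln x + v * ln y) < m"
    using m assms by (metis exp_less_mono exp_ln mult_1)
  then show ?thesis
    using xy by (simp add: powr_def exp_add m_def)
qed

lemma powr_less_tangent:
  fixes p s :: real
  assumes "0 < p" "p < 1" "0 \<le> s" "s \<noteq> 1"
  shows "s powr p < 1 + p * (s - 1)"
  using weighted_am_gm_strict[of p "1 - p" s 1] assms by (simp add: algebra_simps)

text \<open>At p = 0 a factor with exponent 0 appears; the convention 0^0 = 1 of
  \<open>nnpow\<close> keeps the endpoint exact even for b = 0.\<close>

lemma p_mean_0: "p \<noteq> 0 \<Longrightarrow> 0 \<le> a \<Longrightarrow> p_mean p 0 a b = a"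
  "0 \<le> a \<Longrightarrow> p_mean 0 0 a b = a"
  by (simp_all add: p_mean_def nnpow_def powr_powr)

lemma p_mean_1: "p \<noteq> 0 \<Longrightarrow> 0 \<le> b \<Longrightarrow> p_mean p 1 a b = b"
  "0 \<le> b \<Longrightarrow> p_mean 0 1 a b = b"
  by (simp_all add: p_mean_def nnpow_def powr_powr)

lemma p_mean_nonneg: "0 \<le> p_mean p t a b"
  by (simp add: p_mean_def nnpow_def)

lemma p_mean_mult_right:
  assumes "0 \<le> p" "0 \<le> t" "t \<le> 1" "0 \<le> a" "0 \<le> b" "0 \<le> c"
  shows "p_mean p t (a * c) (b * c) = p_mean p t a b * c"
proof (cases "p = 0")
  case True
  then show ?thesis
    using assms by (auto simp: p_mean_def nnpow_def powr_mult powr_add[symmetric] algebra_simps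
        simp flip: powr_add) 
next
  case False
  have "(1 - t) * (a * c) powr p + t * (b * c) powr p = ((1 - t) * a powr p + t * b powr p) * c powr p"
    using assms by (simp add: powr_mult algebra_simps)
  then show ?thesis
    using assms False by (simp add: p_mean_def powr_mult powr_powr)
qed

lemma p_mean_pos:
  assumes "0 \<le> p" "0 < t" "t < 1" "0 < a" "0 < b"
  shows "0 < p_mean p t a b"
proof (cases "p = 0")
  case False
  have "0 < (1 - t) * a powr p + t * b powr p"
    using assms by (intro add_pos_pos mult_pos_pos) auto
  then show ?thesis using False by (simp add: p_mean_def)
qed (use assms in \<open>simp add: p_mean_def nnpow_def\<close>)

lemma p_mean_diag:
  assumes "0 \<le> p" "0 \<le> t" "t \<le> 1" "0 \<le> c"
  shows "p_mean p t c c = c"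
  using p_mean_mult_right[of p t 1 1 c] assms
  by (simp add: p_mean_def nnpow_def)

text \<open>For p > 0, rescale so that the arithmetic mean is 1 and add the tangent bounds z^p <= 1
  + p (z - 1): the linear terms cancel.\<close>

lemma p_mean_less_arith:
  assumes "0 \<le> p" "p < 1" "0 < t" "t < 1" "0 \<le> x" "0 \<le> y" "x \<noteq> y"
  shows "p_mean p t x y < (1 - t) * x + t * y"
proof (cases "p = 0")
  case True
  then show ?thesis
    using weighted_am_gm_strict[of "1 - t" t x y] assms by (simp add: p_mean_def nnpow_def)
next
  case False
  then have p: "0 < p" using assms by simp
  define m where "m = (1 - t) * x + t * y"
  have m: "0 < m"
    using assms unfolding m_def by (cases "x = 0") (auto intro: add_pos_nonneg)
  have "p_mean p t (x / m) (y / m) < 1"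
  proof -
    have le: "z powr p \<le> 1 + p * (z - 1)" if "0 \<le> z" for z
      using powr_less_tangent[OF p \<open>p < 1\<close> that] by (cases "z = 1") auto
    have "x \<noteq> m"
      using assms by (auto simp: m_def algebra_simps)
    then have "(1 - t) * (x / m) powr p + t * (y / m) powr p
        < (1 - t) * (1 + p * (x / m - 1)) + t * (1 + p * (y / m - 1))"
      using assms m p
      by (intro add_less_le_mono mult_strict_left_mono mult_left_mono powr_less_tangent le) auto
    also have "\<dots> = 1 + p * (((1 - t) * x + t * y) / m - 1)"
      by (simp add: algebra_simps add_divide_distrib diff_divide_distrib)
    also have "\<dots> = 1" using m by (simp add: m_def)
    finally have "((1 - t) * (x / m) powr p + t * (y / m) powr p) powr (1 / p) < 1 powr (1 / p)"
      using assms p by (intro powr_less_mono2) auto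
    then show ?thesis using False by (simp add: p_mean_def)
  qed
  moreover have "p_mean p t ((x / m) * m) ((y / m) * m) = p_mean p t (x / m) (y / m) * m"
    using assms m by (intro p_mean_mult_right) auto
  ultimately show ?thesis
    using m by (simp add: m_def)
qed

text \<open>
  Rescaling the arguments by \<open>A\<close> and \<open>B\<close> turns the mean with weight \<open>t\<close> into one with another weight
  \<open>s\<close>, which reduces the tangent at \<open>(A, B)\<close> to the one at \<open>(1, 1)\<close>.
\<close>
lemma p_mean_tangent:
  assumes p: "0 \<le> p" "p < 1" and t: "0 < t" "t < 1" and AB: "0 < A" "0 < B"
  obtains \<alpha> \<beta> where "0 \<le> \<alpha>" "0 \<le> \<beta>" "\<alpha> * A + \<beta> * B = p_mean p t A B"
    "\<And>a b. 0 \<le> a \<Longrightarrow> 0 \<le> b \<Longrightarrow> p_mean p t a b \<le> \<alpha> * a + \<beta> * b"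
    "\<And>a b. 0 \<le> a \<Longrightarrow> 0 \<le> b \<Longrightarrow> p_mean p t a b = \<alpha> * a + \<beta> * b \<Longrightarrow> a * B = b * A"
proof -
  define M where "M = p_mean p t A B"
  have M: "0 < M" unfolding M_def using assms by (intro p_mean_pos) auto
  obtain s where s: "0 < s" "s < 1"
    "\<And>x y. 0 \<le> x \<Longrightarrow> 0 \<le> y \<Longrightarrow> p_mean p t (x * A) (y * B) = M * p_mean p s x y"
  proof (cases "p = 0")
    case True
    then have "p_mean p t (x * A) (y * B) = M * p_mean p t x y" if "0 \<le> x" "0 \<le> y" for x y
      using that assms by (simp add: M_def p_mean_def nnpow_def powr_mult)
    then show ?thesis using t that by blast
  next
    case False
    with p have p0: "0 < p" by simp
    define N where "N = (1 - t) * A powr p + t * B powr p"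
    have parts: "0 < (1 - t) * A powr p" "0 < t * B powr p" using t AB by auto
    then have N: "0 < N" by (simp add: N_def)
    \<comment> \<open>The share of the \<open>B\<close> term in \<open>N\<close>, which is
      M^p.\<close>
    define s where "s = t * B powr p / N"
    have s: "0 < s" "s < 1" using parts N by (auto simp: s_def N_def)
    have s': "N * s = t * B powr p" "N * (1 - s) = (1 - t) * A powr p"
      using N by (simp_all add: s_def N_def right_diff_distrib)
    have "p_mean p t (x * A) (y * B) = M * p_mean p s x y" if "0 \<le> x" "0 \<le> y" for x y
    proof -
      have "(1 - t) * (x * A) powr p + t * (y * B) powr p
          = ((1 - t) * A powr p) * x powr p + (t * B powr p) * y powr p"
        using that AB by (simp add: powr_mult)
      also have "\<dots> = N * ((1 - s) * x powr p + s * y powr p)"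
        unfolding s'[symmetric] by (simp add: algebra_simps)
      finally show ?thesis
        using False N s by (simp add: p_mean_def M_def N_def powr_mult)
    qed
    then show ?thesis using s that by blast
  qed
  \<comment> \<open>The partial derivatives of the mean at (A, B).\<close>
  define \<alpha> \<beta> where "\<alpha> = (1 - s) * M / A" and "\<beta> = s * M / B"
  have mean: "p_mean p t a b = M * p_mean p s (a / A) (b / B)" if "0 \<le> a" "0 \<le> b" for a b
    using s(3)[of "a / A" "b / B"] that AB by simp
  have lin: "\<alpha> * a + \<beta> * b = M * ((1 - s) * (a / A) + s * (b / B))" for a b
    by (simp add: \<alpha>_def \<beta>_def algebra_simps)
  have less: "p_mean p t a b < \<alpha> * a + \<beta> * b" if "0 \<le> a" "0 \<le> b" "a / A \<noteq> b / B" for a b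
    unfolding mean[OF that(1,2)] lin
    using p_mean_less_arith[OF p s(1,2), of "a / A" "b / B"] that AB M by simp
  have eq: "p_mean p t a b = \<alpha> * a + \<beta> * b" if "0 \<le> a" "0 \<le> b" "a / A = b / B" for a b
    unfolding mean[OF that(1,2)] lin that(3)
    using p_mean_diag[of p s "b / B"] that AB s p
    by (simp add: distrib_right[symmetric] del: times_divide_eq_right)
  show ?thesis
  proof (rule that)
    show "0 \<le> \<alpha>" "0 \<le> \<beta>" using s M AB by (auto simp: \<alpha>_def \<beta>_def)
    show "\<alpha> * A + \<beta> * B = p_mean p t A B"
      using eq[of A B] AB by simp
    fix a b :: real assume ab: "0 \<le> a" "0 \<le> b"
    show "p_mean p t a b \<le> \<alpha> * a + \<beta> * b"
      using less[OF ab] eq[OF ab] by fastforce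
    show "a * B = b * A" if "p_mean p t a b = \<alpha> * a + \<beta> * b"
      using less[OF ab] that AB by (force simp: field_simps)
  qed
qed

section \<open>Wulff shapes of p-means\<close>

lemma p_combination_eq:
  assumes "convex_body C" "\<And>y. y \<in> sphere 0 1 \<Longrightarrow>
    p_mean p t (support_fun K0 y) (support_fun K1 y) = support_fun C y"
  shows "p_combination p t K0 K1 = C"
  using assms(2) mem_iff_support_fun[OF assms(1)] by (auto simp: p_combination_def)

lemma p_combination_support_le:
  assumes "convex_body (p_combination p t K0 K1)" "y \<in> sphere 0 1"
  shows "support_fun (p_combination p t K0 K1) y \<le> p_mean p t (support_fun K0 y) (support_fun K1 y)"
  using assms by (intro support_fun_le) (auto simp: p_combination_def inner_commute)

text \<open>By homogeneity the p-mean of \<open>a h\<close> and \<open>b h\<close> is a multiple of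
  \<open>h\<close>, hence itself a support function, and the Wulff shape is exact.\<close>

lemma p_combination_dilates:
  assumes "0 \<le> p" "0 \<le> t" "t \<le> 1" and D: "convex_body D" "0 \<in> D" and "0 \<le> a" "0 \<le> b"
  shows "p_combination p t ((*\<^sub>R) a ` D) ((*\<^sub>R) b ` D) = (*\<^sub>R) (p_mean p t a b) ` D"
  using assms
  by (intro p_combination_eq convex_body_scaleR)
    (simp_all add: support_fun_scaleR_set p_mean_mult_right p_mean_nonneg support_fun_nonneg)

text \<open>Half-spaces give closedness and convexity; boundedness is borrowed from
  \<open>L\<close>, which will be the Minkowski combination from the tangent.\<close>

lemma convex_body_p_combination:
  assumes K0: "convex_body K0" "0 \<in> K0" and K1: "convex_body K1" "0 \<in> K1"
    and sub: "p_combination p t K0 K1 \<subseteq> L" and L: "convex_body L"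
  shows "convex_body (p_combination p t K0 K1)" "0 \<in> p_combination p t K0 K1"
proof -
  let ?K = "p_combination p t K0 K1"
  have eq: "?K = (\<Inter>y\<in>sphere 0 1. {x. y \<bullet> x \<le> p_mean p t (support_fun K0 y) (support_fun K1 y)})"
    by (auto simp: p_combination_def inner_commute)
  show "0 \<in> ?K" by (simp add: p_combination_def p_mean_nonneg)
  moreover have "closed ?K"
    unfolding eq by (intro closed_INT ballI closed_halfspace_le)
  moreover have "convex ?K"
    unfolding eq by (intro convex_INT convex_halfspace_le)
  moreover have "bounded ?K"
    using sub L compact_imp_bounded bounded_subset unfolding convex_body_def by blast
  ultimately show "convex_body ?K"
    by (auto simp: convex_body_def compact_eq_bounded_closed)
qed

section \<open>Positivity of V_1, and the equality case\<close>

lemma intrinsic_volume_1_zero: "intrinsic_volume 1 {0::'a::euclidean_space} = 0"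
  using intrinsic_volume_1_scaleR[of "{0::'a}" 0] by (simp add: convex_body_def)

lemma intrinsic_volume_1_pos:
  fixes K :: "'a::euclidean_space set"
  assumes "convex_body K" "0 \<in> K" "K \<noteq> {0}"
  shows "0 < intrinsic_volume 1 K"
  using intrinsic_volume_1_strict_mono[of "{0}" K] assms
  unfolding intrinsic_volume_1_zero by (auto simp: convex_body_def)

lemma intrinsic_volume_1_nonneg:
  assumes "convex_body K" "0 \<in> K"
  shows "0 \<le> intrinsic_volume 1 K"
  using intrinsic_volume_1_pos[OF assms]
  by (cases "K = {0}") (simp_all add: intrinsic_volume_1_zero del: One_nat_def)

lemma intrinsic_volume_1_p_combination_dilates:
  assumes "0 \<le> p" "0 \<le> t" "t \<le> 1" "convex_body D" "0 \<in> D" "0 \<le> a" "0 \<le> b"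
  shows "intrinsic_volume 1 (p_combination p t ((*\<^sub>R) a ` D) ((*\<^sub>R) b ` D)) =
    p_mean p t (intrinsic_volume 1 ((*\<^sub>R) a ` D)) (intrinsic_volume 1 ((*\<^sub>R) b ` D))"
  using assms
  by (simp add: p_combination_dilates intrinsic_volume_1_scaleR p_mean_mult_right p_mean_nonneg
      intrinsic_volume_1_nonneg del: One_nat_def)

definition dilates :: "'a::euclidean_space set \<Rightarrow> 'a set \<Rightarrow> bool" where
  "dilates K0 K1 \<longleftrightarrow> K0 = {0} \<or> K1 = {0} \<or> (\<exists>c>0. K1 = (*\<^sub>R) c ` K0)"

text \<open>Allowing the factor 0 puts the bodies {0} and the true dilates into one form.\<close>

lemma dilates_common_shape:
  assumes "convex_body K0" "0 \<in> K0" "convex_body K1" "0 \<in> K1" "dilates K0 K1"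
  obtains D a b where "convex_body D" "0 \<in> D" "0 \<le> a" "0 \<le> b"
    "K0 = (*\<^sub>R) a ` D" "K1 = (*\<^sub>R) b ` D"
proof -
  have zero: "(*\<^sub>R) 0 ` D = {0}" if "0 \<in> D" for D :: "'a set" using that by auto
  have one: "(*\<^sub>R) 1 ` D = D" for D :: "'a set" by simp
  consider "K0 = {0}" | "K1 = {0}" | c where "0 < c" "K1 = (*\<^sub>R) c ` K0"
    using assms(5) unfolding dilates_def by blast
  then show ?thesis
  proof cases
    case 1
    then show ?thesis using that[of K1 0 1] zero one assms by simp
  next
    case 2
    then show ?thesis using that[of K0 1 0] zero one assms by simp
  next
    case 3
    then show ?thesis using that[of K0 1 c] one assms by simp
  qed
qed

lemma intrinsic_volume_1_p_combination_less:
  assumes p: "0 \<le> p" "p < 1" and t: "0 < t" "t < 1"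
    and K0: "convex_body K0" "0 \<in> K0" and K1: "convex_body K1" "0 \<in> K1"
    and ndil: "\<not> dilates K0 K1"
  shows "0 \<le> intrinsic_volume 1 (p_combination p t K0 K1)"
    and "intrinsic_volume 1 (p_combination p t K0 K1) <
      p_mean p t (intrinsic_volume 1 K0) (intrinsic_volume 1 K1)"
proof -
  let ?h0 = "support_fun K0" and ?h1 = "support_fun K1"
  define K where "K = p_combination p t K0 K1"
  define A B where "A = intrinsic_volume 1 K0" and "B = intrinsic_volume 1 K1"
  \<comment> \<open>Neither body is {0}, so the tangent can be taken at a point with positive
    coordinates.\<close>
  have AB: "0 < A" "0 < B"
    unfolding A_def B_def using ndil K0 K1 unfolding dilates_def
    by (blast intro: intrinsic_volume_1_pos)+
  obtain \<alpha> \<beta> where \<alpha>\<beta>: "0 \<le> \<alpha>" "0 \<le> \<beta>" "\<alpha> * A + \<beta> * B = p_mean p t A B"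
    "\<And>a b. 0 \<le> a \<Longrightarrow> 0 \<le> b \<Longrightarrow> p_mean p t a b \<le> \<alpha> * a + \<beta> * b"
    "\<And>a b. 0 \<le> a \<Longrightarrow> 0 \<le> b \<Longrightarrow> p_mean p t a b = \<alpha> * a + \<beta> * b \<Longrightarrow> a * B = b * A"
    using p_mean_tangent[OF p t AB] by blast
  define L where "L = (*\<^sub>R) \<alpha> ` K0 + (*\<^sub>R) \<beta> ` K1"
  have sc: "convex_body ((*\<^sub>R) \<alpha> ` K0)" "0 \<in> (*\<^sub>R) \<alpha> ` K0" "convex_body ((*\<^sub>R) \<beta> ` K1)" "0 \<in> (*\<^sub>R) \<beta> ` K1"
    using K0 K1 by (force intro: convex_body_scaleR)+
  have L: "convex_body L" unfolding L_def using sc by (intro convex_body_plus)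
  have hL: "support_fun L y = \<alpha> * ?h0 y + \<beta> * ?h1 y" for y
    unfolding L_def using K0 K1 sc \<alpha>\<beta>(1,2) by (simp add: support_fun_plus support_fun_scaleR_set)
  have h: "0 \<le> ?h0 y" "0 \<le> ?h1 y" for y
    using K0 K1 by (auto intro: support_fun_nonneg)
  have "K \<subseteq> L"
  proof
    fix x assume "x \<in> K"
    then have "x \<bullet> y \<le> support_fun L y" if "y \<in> sphere 0 1" for y
      using \<alpha>\<beta>(4)[OF h, of y y] that unfolding hL by (force simp: K_def p_combination_def)
    then show "x \<in> L" using mem_iff_support_fun[OF L] by blast
  qed
  then have K: "convex_body K" "0 \<in> K"
    using convex_body_p_combination[OF K0 K1 _ L] unfolding K_def by auto
  have "K \<noteq> L"
  proof
    assume "K = L"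
    \<comment> \<open>If \<open>K = L\<close>, the chain h_L = h_K <= p-mean <= tangent = h_L
      collapses in every direction, and the equality case of the tangent applies.\<close>
    have ratio: "?h1 y = (B / A) * ?h0 y" if y: "y \<in> sphere 0 1" for y
    proof -
      have "support_fun L y \<le> p_mean p t (?h0 y) (?h1 y)"
        using p_combination_support_le[OF _ y, of p t K0 K1] K(1) \<open>K = L\<close> by (simp add: K_def)
      then have "p_mean p t (?h0 y) (?h1 y) = \<alpha> * ?h0 y + \<beta> * ?h1 y"
        using \<alpha>\<beta>(4)[OF h, of y y] unfolding hL by simp
      then have "?h0 y * B = ?h1 y * A" by (rule \<alpha>\<beta>(5)[OF h])
      then show ?thesis using AB by (simp add: field_simps)
    qed
    have "K1 = (*\<^sub>R) (B / A) ` K0"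
      using K0 K1 AB ratio by (intro convex_body_eqI convex_body_scaleR) (auto simp: support_fun_scaleR_set)
    moreover have "0 < B / A"
      using AB by simp
    ultimately show False
      using ndil unfolding dilates_def by blast
  qed
  then have "intrinsic_volume 1 K < intrinsic_volume 1 L"
    using \<open>K \<subseteq> L\<close> K L by (intro intrinsic_volume_1_strict_mono) auto
  also have "\<dots> = \<alpha> * A + \<beta> * B"
    unfolding L_def A_def B_def using K0 K1 sc \<alpha>\<beta>(1,2)
    by (simp add: intrinsic_volume_1_plus intrinsic_volume_1_scaleR del: One_nat_def)
  finally show "intrinsic_volume 1 (p_combination p t K0 K1) <
      p_mean p t (intrinsic_volume 1 K0) (intrinsic_volume 1 K1)"
    using \<alpha>\<beta>(3) by (simp add: K_def A_def B_def)
  show "0 \<le> intrinsic_volume 1 (p_combination p t K0 K1)"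
    using intrinsic_volume_1_nonneg[OF K] by (simp add: K_def)
qed

text \<open>At t = 0 and t = 1 the combination is one of the two bodies and equality is automatic;
  strictly between, the bodies are either dilates or fall under the strict inequality.\<close>

lemma intrinsic_volume_1_p_combination:
  assumes p: "0 \<le> p" "p < 1" and t: "0 \<le> t" "t \<le> 1"
    and K0: "convex_body K0" "0 \<in> K0" and K1: "convex_body K1" "0 \<in> K1"
  shows "intrinsic_volume 1 (p_combination p t K0 K1) \<le>
      p_mean p t (intrinsic_volume 1 K0) (intrinsic_volume 1 K1)" (is "?v \<le> ?m")
    and "dilates K0 K1 \<Longrightarrow> intrinsic_volume 1 (p_combination p t K0 K1) =
      p_mean p t (intrinsic_volume 1 K0) (intrinsic_volume 1 K1)"
    and "0 \<le> intrinsic_volume 1 (p_combination p t K0 K1)"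
proof -
  have dil: "?v = ?m" if "dilates K0 K1"
    using dilates_common_shape[OF K0 K1 that] intrinsic_volume_1_p_combination_dilates[OF p(1) t] by metis
  show "dilates K0 K1 \<Longrightarrow> ?v = ?m" by (rule dil)
  have h: "0 \<le> support_fun K0 y" "0 \<le> support_fun K1 y" for y
    using K0 K1 by (auto intro: support_fun_nonneg)
  have ends: "?v = ?m" if "t = 0 \<or> t = 1"
    using that
  proof
    assume t0: "t = 0"
    have "p_combination p t K0 K1 = K0"
      using K0 h t0 by (intro p_combination_eq) (cases "p = 0"; simp add: p_mean_0)+
    then show ?thesis using K0 t0 by (cases "p = 0") (simp_all add: p_mean_0 intrinsic_volume_1_nonneg del: One_nat_def)
  next
    assume t1: "t = 1"
    have "p_combination p t K0 K1 = K1"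
      using K1 h t1 by (intro p_combination_eq) (cases "p = 0"; simp add: p_mean_1)+
    then show ?thesis using K1 t1 by (cases "p = 0") (simp_all add: p_mean_1 intrinsic_volume_1_nonneg del: One_nat_def)
  qed
  show "?v \<le> ?m" "0 \<le> ?v"
    using dil ends p_mean_nonneg[of p t] t
      intrinsic_volume_1_p_combination_less[OF p _ _ K0 K1, of t]
    by fastforce+
qed

text \<open>For p = 0 a literal p-th power would reduce the claim to 1 <= 1, so the inequality is
  read as V_1 against the geometric mean. The equivalence is restricted to 0 < t < 1 because at the
  endpoints both sides agree for all bodies.\<close>

theorem theorem1p5:
  fixes p t :: real and K0 K1 :: "(real ^ 'n) set"
  assumes "CARD('n) \<ge> 3"
    and "0 \<le> p" and "p < 1"
    and "0 \<le> t" and "t \<le> 1"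
    and "convex_body K0" and "0 \<in> K0"
    and "convex_body K1" and "0 \<in> K1"
  shows
    "let V1 = intrinsic_volume 1;
         K = p_combination p t K0 K1;
         lhs = (if p = 0 then V1 K else V1 K powr p);
         rhs = (if p = 0 then nnpow (V1 K0) (1 - t) * nnpow (V1 K1) t
                else (1 - t) * V1 K0 powr p + t * V1 K1 powr p);
         extremal = (K0 = {0} \<or> K1 = {0} \<or> (\<exists>c>0. K1 = (\<lambda>x. c *\<^sub>R x) ` K0))
     in lhs \<le> rhs \<and>
        (extremal \<longrightarrow> lhs = rhs) \<and>
        (0 < t \<and> t < 1 \<longrightarrow> (lhs = rhs \<longleftrightarrow> extremal))"
proof -
  define v where "v = intrinsic_volume 1 (p_combination p t K0 K1)"
  define A B where "A = intrinsic_volume 1 K0" and "B = intrinsic_volume 1 K1"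
  define m where "m = p_mean p t A B"
  define lhs where "lhs = (if p = 0 then v else v powr p)"
  define rhs where "rhs = (if p = 0 then nnpow A (1 - t) * nnpow B t
    else (1 - t) * A powr p + t * B powr p)"
  have v: "v \<le> m" "0 \<le> v" "dilates K0 K1 \<Longrightarrow> v = m"
    using intrinsic_volume_1_p_combination[OF assms(2-9)] by (simp_all add: v_def m_def A_def B_def)
  have v_less: "v < m" if "0 < t" "t < 1" "\<not> dilates K0 K1"
    using intrinsic_volume_1_p_combination_less(2)[OF assms(2,3) that(1,2) assms(6-9) that(3)]
    by (simp add: v_def m_def A_def B_def)
  \<comment> \<open>The right side is the mean itself for p = 0 and its p-th power otherwise, so
    both bounds on \<open>v\<close> transfer by monotonicity.\<close>
  have rhs: "rhs = (if p = 0 then m else m powr p)"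
    using assms(2-5) by (simp add: rhs_def m_def p_mean_def powr_powr)
  have "lhs \<le> rhs"
    unfolding lhs_def rhs using v(1,2) assms(2) by (auto intro: powr_mono2)
  moreover have "dilates K0 K1 \<Longrightarrow> lhs = rhs"
    using v(3) by (simp add: lhs_def rhs)
  moreover have "lhs < rhs" if "0 < t" "t < 1" "\<not> dilates K0 K1"
    unfolding lhs_def rhs using v_less[OF that] v(2) assms(2) by (auto intro: powr_less_mono2)
  ultimately show ?thesis
    unfolding Let_def dilates_def[symmetric] v_def[symmetric] A_def[symmetric] B_def[symmetric]
      lhs_def[symmetric] rhs_def[symmetric]
    by auto
qed

end
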